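(* (i) Let $h:\mathbb{R}\to\mathbb{R}$ be three times differentiable with $\|h'''\|_\infty<\infty$. For $r\ge1$ let $Z_r$ be a random variable with law $\widetilde\mu^{(r)}$ and let $Y$ be a standard normal random variable. Then \[\big|\mathbb{E}(h(Z_r))-\mathbb{E}(h(Y))\big| = O\!\left(\frac{1}{\sqrt{\rho(r)}}\right)\quad\text{as }\rho(r)\to\infty.\] (ii) Let $F_r$ be the cumulative distribution function of $\widetilde\mu^{(r)}$ and $F$ that of $\mathcal{N}(0,1)$. There is a constant $\widetilde K>0$ (depending only on $b$) such that for every integer $r\ge1$, \[\sup_{t\in\mathbb{R}}|F_r(t)-F(t)|\le \frac{\widetilde K}{\rho(r)^{1/8}}.\]
   Context: Fix an integer $b\ge 2$. For $n\in\mathbb{N}$ with base-$b$ digits $n_k\in\{0,\dots,b-1\}$, $s(n):=\sum_k n_k$. For $r,n\in\mathbb{N}$, $\Delta^{(r)}(n):=s(n+r)-s(n)$ and $\mu^{(r)}(d):=\lim_{N\to\infty}\frac1N|\{n<N:\Delta^{(r)}(n)=d\}|$ ($d\in\mathbb{Z}$); these limits exist and $\mu^{(r)}$ is a probability measure on $\mathbb{Z}$ with finite moments. For $r\ge1$, $\sigma_r:=\sqrt{\mathrm{Var}(\mu^{(r)})}>0$ and $\widetilde\mu^{(r)}$ is the probability measure on $\mathbb{R}$ supported on $\{d/\sigma_r:d\in\mathbb{Z}\}$ with $\widetilde\mu^{(r)}(\{d/\sigma_r\})=\mu^{(r)}(d)$. Blocks: write the expansion of $r\ge1$ as the digit string $r_\ell\cdots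 r_0$, $r_\ell\ne0$. A block is either a maximal run of consecutive $0$ digits, or a maximal run of consecutive digits equal to $b-1$, or (when $b\ge3$) a single digit with value in $\{1,\dots,b-2\}$; $\rho(r)$ is the number of blocks of $r$. *)

theory Defs
  imports "HOL-Probability.Probability"
begin

fun digits :: "nat \<Rightarrow> nat \<Rightarrow> nat list" where
  "digits b n = (if b < 2 \<or> n = 0 then [] else n mod b # digits b (n div b))"

declare digits.simps[simp del]

definition digsum :: "nat \<Rightarrow> nat \<Rightarrow> nat" where
  "digsum b n = sum_list (digits b n)"

definition Delta :: "nat \<Rightarrow> nat \<Rightarrow> nat \<Rightarrow> int" where
  "Delta b r n = int (digsum b (n + r)) - int (digsum b n)"

definition mu :: "nat \<Rightarrow> nat \<Rightarrow> int \<Rightarrow> real" where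
  "mu b r d = lim (\<lambda>N. real (card {n. n < N \<and> Delta b r n = d}) / real N)"

definition sigma :: "nat \<Rightarrow> nat \<Rightarrow> real" where
  "sigma b r = sqrt ((\<Sum>\<^sub>\<infinity>d\<in>UNIV. (real_of_int d)\<^sup>2 * mu b r d)
                     - (\<Sum>\<^sub>\<infinity>d\<in>UNIV. real_of_int d * mu b r d)\<^sup>2)"

(* E h(Z_r) where Z_r has law mu~^(r): mass mu^(r)(d) at d / sigma_r *)
definition expect_tilde :: "nat \<Rightarrow> nat \<Rightarrow> (real \<Rightarrow> real) \<Rightarrow> real" where
  "expect_tilde b r h = (\<Sum>\<^sub>\<infinity>d\<in>UNIV. mu b r d * h (real_of_int d / sigma b r))"

definition cdf_tilde :: "nat \<Rightarrow> nat \<Rightarrow> real \<Rightarrow> real" where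
  "cdf_tilde b r t = (\<Sum>\<^sub>\<infinity>d\<in>{d. real_of_int d / sigma b r \<le> t}. mu b r d)"

(* number of blocks of r: a block starts at position i (digit r_i, i <= l) iff
   i = 0, or r_i differs from r_(i-1), or r_i is not in {0, b-1}
   (runs of 0s and runs of (b-1)s are merged; every other digit is its own block) *)
definition rho :: "nat \<Rightarrow> nat \<Rightarrow> nat" where
  "rho b r = (let ds = digits b r in
     card {i. i < length ds \<and>
              (i = 0 \<or> ds ! i \<noteq> ds ! (i - 1) \<or> ds ! i \<notin> {0, b - 1})})"

end

theory Submission
  imports Defs "HOL-Real_Asymp.Real_Asymp"
begin

text \<open>
  Draw the digits of \<open>n\<close> independently and uniformly, from the lowest upwards, and let \<open>c\<close> be the
  carry into position \<open>k\<close> when \<open>r\<close> is added. With \<open>q = r\<^sub>k + c\<close>, the digit of \<open>n + r\<close> at position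
  \<open>k\<close> minus that of \<open>n\<close> is \<open>q\<close> (no carry out) with probability \<open>(b - q) / b\<close> and \<open>q - b\<close> (carry
  out) with probability \<open>q / b\<close>. Hence the partial sums of these differences form a martingale, with
  conditional step variance \<open>q (b - q)\<close>, and \<open>\<Delta>\<close> is its limit; in particular \<open>\<mu>\<close> is centred and its
  variance \<open>\<sigma>\<^sup>2\<close> is the sum of the mean step variances. Each block of \<open>r\<close> contributes at least \<open>1 / 2\<close>
  to this sum.

  Replace the steps one by one by Gaussian ones (Lindeberg). Third-order Taylor expansion costs a
  multiple of \<open>\<sigma>\<^sup>2\<close> times the bound on the third derivative. The step variances are random, but affine in
  the carry, and the correlation of the carry with a Lipschitz function of the martingale contracts by
  the factor \<open>1 / b\<close> at every digit, so that the error from this source is again \<open>O(\<sigma>\<^sup>2)\<close>. After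
  rescaling by \<open>\<sigma>\<close> the total error is \<open>O(1 / \<sigma>) = O(\<rho>\<^bsup>-1/2\<^esup>)\<close>. The bound on the distribution functions
  follows by smoothing the indicator at scale \<open>\<delta> = \<rho>\<^bsup>-1/8\<^esup>\<close>, where the error is \<open>O(\<delta> + \<delta>\<^sup>-\<^sup>3 \<rho>\<^bsup>-1/2\<^esup>)\<close>.
\<close>

subsection \<open>Gaussian averages and third-order Taylor bounds\<close>

text \<open>The growth that a bounded third derivative permits; the third absolute moment of the
  normal law makes it integrable.\<close>

definition cubic_growth :: "(real \<Rightarrow> real) \<Rightarrow> bool" where
  "cubic_growth g \<longleftrightarrow> g \<in> borel_measurable borel \<and> (\<exists>A. \<forall>x. \<bar>g x\<bar> \<le> A * (1 + \<bar>x\<bar> ^ 3))"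

text \<open>Convolution with the centred normal law of variance \<open>w\<close>. The parameter is
  the variance, so that parameters add under composition, and rescaling a standard normal variable
  makes \<open>w = 0\<close> the identity.\<close>

definition gauss :: "real \<Rightarrow> (real \<Rightarrow> real) \<Rightarrow> real \<Rightarrow> real" where
  "gauss w g x = (LINT y|std_normal_distribution. g (x + sqrt w * y))"

text \<open>
  Stated with the remainder bound instead of a third derivative, the condition passes to Gaussian
  averages without differentiating under the integral sign.
\<close>

definition taylor3 :: "real \<Rightarrow> (real \<Rightarrow> real) \<Rightarrow> (real \<Rightarrow> real) \<Rightarrow> (real \<Rightarrow> real) \<Rightarrow> bool" where
  "taylor3 M g g1 g2 \<longleftrightarrow> g1 \<in> borel_measurable borel \<and>
     (\<forall>x t. \<bar>g (x + t) - g x - g1 x * t - g2 x * t\<^sup>2 / 2\<bar> \<le> M * \<bar>t\<bar> ^ 3) \<and>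
     (\<forall>x y. \<bar>g2 x - g2 y\<bar> \<le> 6 * M * \<bar>x - y\<bar>)"

section \<open>Third moments of the normal law and integrability\<close>

lemma abs_add_cubed_le: "\<bar>x + y\<bar> ^ 3 \<le> 4 * (\<bar>x\<bar> ^ 3 + \<bar>y\<bar> ^ 3)" for x y :: real
proof -
  define a c where "a = \<bar>x\<bar>" and "c = \<bar>y\<bar>"
  have ac: "a \<ge> 0" "c \<ge> 0" by (auto simp: a_def c_def)
  have "\<bar>x + y\<bar> ^ 3 \<le> (a + c) ^ 3"
    unfolding a_def c_def by (intro power_mono abs_triangle_ineq) auto
  also have "4 * (a ^ 3 + c ^ 3) - (a + c) ^ 3 = 3 * (a + c) * (a - c)\<^sup>2"
    by (simp add: power2_eq_square power3_eq_cube algebra_simps)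
  then have "(a + c) ^ 3 \<le> 4 * (a ^ 3 + c ^ 3)"
    using ac by (smt (verit) mult_nonneg_nonneg zero_le_power2)
  finally show ?thesis unfolding a_def c_def .
qed

lemma prob_space_std_normal: "prob_space std_normal_distribution"
  using real_dist_normal_dist by (simp add: real_distribution_def)

lemma sets_std_normal [measurable_cong]: "sets std_normal_distribution = sets borel"
  by simp

lemma integrable_std_normal_cubed: "integrable std_normal_distribution (\<lambda>y. \<bar>y\<bar> ^ 3)"
  using integrable_std_normal_moment_abs[of 3]
  by (subst integrable_density) (auto simp: ac_simps)

text \<open>The exact value is \<open>2 * sqrt (2 / pi)\<close>; it is rounded up, since only the
  order of the final bounds matters.\<close>

lemma integral_std_normal_cubed_le: "(LINT y|std_normal_distribution. \<bar>y\<bar> ^ 3) \<le> 2"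
proof -
  have "(LINT y|std_normal_distribution. \<bar>y\<bar> ^ 3) = sqrt (2 / pi) * 2"
    using std_normal_distribution_odd_moments_abs(1)[of 1] by (simp add: numeral_3_eq_3)
  also have "sqrt (2 / pi) \<le> 1"
    using pi_gt3 by (subst real_sqrt_le_1_iff) (simp add: field_simps)
  finally show ?thesis by simp
qed

lemma integrable_cubic_growth:
  assumes "cubic_growth g"
  shows "integrable std_normal_distribution (\<lambda>y. g (x + s * y))"
proof -
  interpret prob_space std_normal_distribution by (rule prob_space_std_normal)
  obtain A where A: "\<And>x. \<bar>g x\<bar> \<le> A * (1 + \<bar>x\<bar> ^ 3)" and [measurable]: "g \<in> borel_measurable borel"
    using assms unfolding cubic_growth_def by auto
  have "A \<ge> 0" using A[of 0] by simp
  have "integrable std_normal_distribution (\<lambda>y. A * (1 + 4 * (\<bar>x\<bar> ^ 3 + \<bar>s\<bar> ^ 3 * \<bar>y\<bar> ^ 3)))"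
    using integrable_std_normal_cubed by auto
  then show ?thesis
  proof (rule Bochner_Integration.integrable_bound)
    show "AE y in std_normal_distribution. norm (g (x + s * y))
        \<le> norm (A * (1 + 4 * (\<bar>x\<bar> ^ 3 + \<bar>s\<bar> ^ 3 * \<bar>y\<bar> ^ 3)))"
    proof (rule AE_I2)
      fix y
      have "\<bar>g (x + s * y)\<bar> \<le> A * (1 + \<bar>x + s * y\<bar> ^ 3)" by (rule A)
      also have "\<dots> \<le> A * (1 + 4 * (\<bar>x\<bar> ^ 3 + \<bar>s * y\<bar> ^ 3))"
        using \<open>A \<ge> 0\<close> abs_add_cubed_le[of x "s * y"] by (intro mult_left_mono) auto
      also have "\<bar>s * y\<bar> ^ 3 = \<bar>s\<bar> ^ 3 * \<bar>y\<bar> ^ 3" by (simp add: abs_mult power_mult_distrib)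
      finally show "norm (g (x + s * y)) \<le> norm (A * (1 + 4 * (\<bar>x\<bar> ^ 3 + \<bar>s\<bar> ^ 3 * \<bar>y\<bar> ^ 3)))"
        by simp
    qed
  qed auto
qed

section \<open>Consequences of the third-order Taylor condition\<close>

lemma taylor3_nonneg: "taylor3 M g g1 g2 \<Longrightarrow> M \<ge> 0"
  unfolding taylor3_def
  by (smt (verit) abs_one mult_cancel_left2 power_one)

text \<open>\<open>g\<close> is continuous because the remainder and the non-constant Taylor terms
  vanish as \<open>t\<close> tends to 0, and \<open>g2\<close> is continuous because it is
  Lipschitz. Measurability of \<open>g1\<close> is part of the definition.\<close>

lemma taylor3_measurable:
  assumes "taylor3 M g g1 g2"
  shows "g \<in> borel_measurable borel" "g1 \<in> borel_measurable borel" "g2 \<in> borel_measurable borel"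
proof -
  have *: "\<And>x t. \<bar>g (x + t) - g x - g1 x * t - g2 x * t\<^sup>2 / 2\<bar> \<le> M * \<bar>t\<bar> ^ 3"
    and **: "\<And>x y. \<bar>g2 x - g2 y\<bar> \<le> 6 * M * \<bar>x - y\<bar>"
    using assms unfolding taylor3_def by auto
  have "isCont g x" for x
  proof -
    have 1: "((\<lambda>t. g (x + t) - g x - g1 x * t - g2 x * t\<^sup>2 / 2) \<longlongrightarrow> 0) (at 0)"
      by (rule Lim_null_comparison[of _ "\<lambda>t. M * \<bar>t\<bar> ^ 3"])
         (use * in \<open>auto intro!: always_eventually tendsto_eq_intros\<close>)
    have 2: "((\<lambda>t. g x + g1 x * t + g2 x * t\<^sup>2 / 2) \<longlongrightarrow> g x + g1 x * 0 + g2 x * 0\<^sup>2 / 2) (at 0)"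
      by (intro tendsto_intros) auto
    have "((\<lambda>t. g (x + t)) \<longlongrightarrow> g x) (at 0)"
      using tendsto_add[OF 1 2] by simp
    then show ?thesis by (simp add: isCont_def LIM_offset_zero_iff[of x])
  qed
  then show "g \<in> borel_measurable borel"
    by (intro borel_measurable_continuous_onI) (simp add: continuous_at_imp_continuous_on)
  show "g1 \<in> borel_measurable borel" using assms unfolding taylor3_def by auto
  have "isCont g2 x" for x
  proof -
    have "((\<lambda>y. g2 y - g2 x) \<longlongrightarrow> 0) (at x)"
      by (rule Lim_null_comparison[of _ "\<lambda>y. 6 * M * \<bar>y - x\<bar>"])
         (use ** in \<open>auto intro!: always_eventually tendsto_eq_intros\<close>)
    then show ?thesis by (simp add: isCont_def LIM_zero_iff)
  qed
  then show "g2 \<in> borel_measurable borel"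
    by (intro borel_measurable_continuous_onI) (simp add: continuous_at_imp_continuous_on)
qed

lemma le_one_plus_cubed: "0 \<le> x \<Longrightarrow> x \<le> 1 + x ^ 3" "0 \<le> x \<Longrightarrow> x\<^sup>2 \<le> 1 + x ^ 3" for x :: real
proof -
  assume x: "0 \<le> x"
  show "x\<^sup>2 \<le> 1 + x ^ 3"
  proof (cases "x \<le> 1")
    case True then have "x\<^sup>2 \<le> 1" using x by (simp add: power_le_one)
    moreover have "x ^ 3 \<ge> 0" using x by simp
    ultimately show ?thesis by linarith
  next
    case False then have "x\<^sup>2 \<le> x ^ 3" by (intro power_increasing) auto
    then show ?thesis by simp
  qed
  show "x \<le> 1 + x ^ 3"
  proof (cases "x \<le> 1")
    case True
    moreover have "x ^ 3 \<ge> 0" using x by simp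
    ultimately show ?thesis by linarith
  next
    case False then have "x ^ 1 \<le> x ^ 3" by (intro power_increasing) auto
    then show ?thesis by simp
  qed
qed

text \<open>Expansion at 0 bounds \<open>g\<close>, and the Lipschitz condition bounds
  \<open>g2\<close>. This makes all three functions integrable against normal laws.\<close>

lemma taylor3_cubic_growth:
  assumes "taylor3 M g g1 g2"
  shows "cubic_growth g" "cubic_growth g1" "cubic_growth g2"
proof -
  have *: "\<And>x t. \<bar>g (x + t) - g x - g1 x * t - g2 x * t\<^sup>2 / 2\<bar> \<le> M * \<bar>t\<bar> ^ 3"
    and **: "\<And>x y. \<bar>g2 x - g2 y\<bar> \<le> 6 * M * \<bar>x - y\<bar>"
    using assms unfolding taylor3_def by auto
  note M = taylor3_nonneg[OF assms]
  define A where "A = \<bar>g 0\<bar> + \<bar>g1 0\<bar> + \<bar>g2 0\<bar> + M"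
  have A: "\<bar>g x\<bar> \<le> A * (1 + \<bar>x\<bar> ^ 3)" for x
  proof -
    have "\<bar>g x - g 0 - g1 0 * x - g2 0 * x\<^sup>2 / 2\<bar> \<le> M * \<bar>x\<bar> ^ 3" using *[of 0 x] by simp
    then have "\<bar>g x\<bar> \<le> \<bar>g 0\<bar> + \<bar>g1 0 * x\<bar> + \<bar>g2 0 * x\<^sup>2 / 2\<bar> + M * \<bar>x\<bar> ^ 3" by linarith
    moreover have "\<bar>g1 0 * x\<bar> \<le> \<bar>g1 0\<bar> * (1 + \<bar>x\<bar> ^ 3)"
      unfolding abs_mult by (intro mult_left_mono le_one_plus_cubed) auto
    moreover have "\<bar>g2 0 * x\<^sup>2 / 2\<bar> \<le> \<bar>g2 0\<bar> * (1 + \<bar>x\<bar> ^ 3)"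
    proof -
      have "\<bar>g2 0 * x\<^sup>2 / 2\<bar> \<le> \<bar>g2 0\<bar> * \<bar>x\<bar>\<^sup>2" by (simp add: abs_mult)
      also have "\<dots> \<le> \<bar>g2 0\<bar> * (1 + \<bar>x\<bar> ^ 3)" by (intro mult_left_mono le_one_plus_cubed) auto
      finally show ?thesis .
    qed
    moreover have "\<bar>g 0\<bar> \<le> \<bar>g 0\<bar> * (1 + \<bar>x\<bar> ^ 3)" "M * \<bar>x\<bar> ^ 3 \<le> M * (1 + \<bar>x\<bar> ^ 3)"
      using M by (auto simp: algebra_simps)
    ultimately show ?thesis unfolding A_def distrib_right by linarith
  qed
  show "cubic_growth g" using A taylor3_measurable[OF assms] unfolding cubic_growth_def by blast
  define B where "B = \<bar>g2 0\<bar> + 6 * M"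
  have B: "\<bar>g2 x\<bar> \<le> B * (1 + \<bar>x\<bar> ^ 3)" for x
  proof -
    have "\<bar>g2 x\<bar> \<le> \<bar>g2 0\<bar> + 6 * M * \<bar>x\<bar>" using **[of x 0] by simp
    moreover have "6 * M * \<bar>x\<bar> \<le> 6 * M * (1 + \<bar>x\<bar> ^ 3)"
      using M by (intro mult_left_mono le_one_plus_cubed) auto
    moreover have "\<bar>g2 0\<bar> \<le> \<bar>g2 0\<bar> * (1 + \<bar>x\<bar> ^ 3)" by (auto simp: algebra_simps)
    ultimately show ?thesis unfolding B_def distrib_right by linarith
  qed
  show "cubic_growth g2" using B taylor3_measurable[OF assms] unfolding cubic_growth_def by blast
  \<comment> \<open>The expansion with increment \<open>t = 1\<close> is solved for
    \<open>g1 x\<close>. The 9 is 8 from \<open>g (x + 1)\<close> plus 1 from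
    \<open>g x\<close>.\<close>
  have "\<bar>g1 x\<bar> \<le> (9 * A + B + M) * (1 + \<bar>x\<bar> ^ 3)" for x
  proof -
    have "\<bar>g1 x\<bar> \<le> \<bar>g (x + 1)\<bar> + \<bar>g x\<bar> + \<bar>g2 x\<bar> + M" using *[of x 1] by simp
    also have "\<bar>g (x + 1)\<bar> \<le> A * (1 + \<bar>x + 1\<bar> ^ 3)" by (rule A)
    also have "\<dots> \<le> A * (8 * (1 + \<bar>x\<bar> ^ 3))"
    proof (rule mult_left_mono)
      show "1 + \<bar>x + 1\<bar> ^ 3 \<le> 8 * (1 + \<bar>x\<bar> ^ 3)"
        using abs_add_cubed_le[of x 1] zero_le_power_abs[of x 3] by (smt (verit) abs_one power_one)
    qed (use M in \<open>auto simp: A_def\<close>)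
    also have "M \<le> M * (1 + \<bar>x\<bar> ^ 3)" using M by (simp add: algebra_simps)
    finally show ?thesis using A[of x] B[of x] unfolding distrib_right by linarith
  qed
  then show "cubic_growth g1" using taylor3_measurable[OF assms] unfolding cubic_growth_def by blast
qed

text \<open>Both bounds are uniform in the base point, so they survive averaging over translates
  with the same \<open>M\<close>. Functions already smoothed can thus be fed into the next
  replacement step.\<close>

lemma taylor3_gauss:
  assumes "taylor3 M g g1 g2"
  shows "taylor3 M (gauss w g) (gauss w g1) (gauss w g2)"
proof -
  interpret prob_space std_normal_distribution by (rule prob_space_std_normal)
  have *: "\<And>x t. \<bar>g (x + t) - g x - g1 x * t - g2 x * t\<^sup>2 / 2\<bar> \<le> M * \<bar>t\<bar> ^ 3"
    and **: "\<And>x y. \<bar>g2 x - g2 y\<bar> \<le> 6 * M * \<bar>x - y\<bar>"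
    using assms unfolding taylor3_def by auto
  note [measurable] = taylor3_measurable[OF assms]
  note int [simp] = taylor3_cubic_growth[OF assms, THEN integrable_cubic_growth]
  show ?thesis unfolding taylor3_def
  proof (intro conjI allI)
    show "gauss w g1 \<in> borel_measurable borel"
      unfolding gauss_def by measurable
    fix x t
    let ?f = "\<lambda>y. g (x + sqrt w * y + t) - g (x + sqrt w * y) - g1 (x + sqrt w * y) * t
                 - g2 (x + sqrt w * y) * t\<^sup>2 / 2"
    have i: "integrable std_normal_distribution (\<lambda>y. g (x + sqrt w * y + t))"
      using int(1)[of "x + t" "sqrt w"] by (simp add: algebra_simps)
    let ?L = "gauss w g (x + t) - gauss w g x - gauss w g1 x * t - gauss w g2 x * t\<^sup>2 / 2"
    have "?L = (LINT y|std_normal_distribution. ?f y)"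
      using i by (simp add: gauss_def add.assoc add.commute[of t])
    then have "\<bar>?L\<bar> \<le> (LINT y|std_normal_distribution. \<bar>?f y\<bar>)"
      by (simp only: integral_abs_bound)
    also have "\<dots> \<le> (LINT y|std_normal_distribution. M * \<bar>t\<bar> ^ 3)"
    proof (rule integral_mono)
      show "integrable std_normal_distribution (\<lambda>y. \<bar>?f y\<bar>)"
        using i by (intro integrable_abs Bochner_Integration.integrable_diff) simp_all
    qed (use * in simp_all)
    also have "\<dots> = M * \<bar>t\<bar> ^ 3" using prob_space by simp
    finally show "\<bar>gauss w g (x + t) - gauss w g x - gauss w g1 x * t - gauss w g2 x * t\<^sup>2 / 2\<bar> \<le> M * \<bar>t\<bar> ^ 3" .
  next
    fix x y
    let ?L = "gauss w g2 x - gauss w g2 y"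
    have "?L = (LINT z|std_normal_distribution. g2 (x + sqrt w * z) - g2 (y + sqrt w * z))"
      by (simp add: gauss_def)
    then have "\<bar>?L\<bar> \<le> (LINT z|std_normal_distribution. \<bar>g2 (x + sqrt w * z) - g2 (y + sqrt w * z)\<bar>)"
      by (simp only: integral_abs_bound)
    also have "\<dots> \<le> (LINT z|std_normal_distribution. 6 * M * \<bar>x - y\<bar>)"
      by (intro integral_mono) (auto intro!: order_trans[OF **])
    also have "\<dots> = 6 * M * \<bar>x - y\<bar>" using prob_space by simp
    finally show "\<bar>gauss w g2 x - gauss w g2 y\<bar> \<le> 6 * M * \<bar>x - y\<bar>" .
  qed
qed

text \<open>Expand at \<open>x\<close> with increment \<open>sqrt w * y\<close>: the linear term has
  mean 0, the quadratic one has mean \<open>w * g2 x / 2\<close>, and the remainder is a third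
  absolute moment.\<close>

lemma gauss_taylor_bound:
  assumes "taylor3 M g g1 g2" and "w \<ge> 0"
  shows "\<bar>gauss w g x - g x - w * g2 x / 2\<bar> \<le> 2 * M * w * sqrt w"
proof -
  interpret prob_space std_normal_distribution by (rule prob_space_std_normal)
  have *: "\<And>x t. \<bar>g (x + t) - g x - g1 x * t - g2 x * t\<^sup>2 / 2\<bar> \<le> M * \<bar>t\<bar> ^ 3"
    using assms unfolding taylor3_def by auto
  note M = taylor3_nonneg[OF assms(1)]
  note int [simp] = taylor3_cubic_growth(1)[OF assms(1), THEN integrable_cubic_growth]
  have m: "integrable std_normal_distribution (\<lambda>y::real. y)" "(LINT y|std_normal_distribution. y) = 0"
    "integrable std_normal_distribution (\<lambda>y::real. y\<^sup>2)" "(LINT y|std_normal_distribution. y\<^sup>2) = 1"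
    using integrable_std_normal_distribution_moment[of 1] integral_std_normal_distribution_moment_odd[of 1]
      integrable_std_normal_distribution_moment[of 2] std_normal_distribution_even_moments(1)[of 1]
    by simp_all
  let ?f = "\<lambda>y. g (x + sqrt w * y) - g x - (g1 x * sqrt w) * y - (g2 x * w / 2) * y\<^sup>2"
  let ?L = "gauss w g x - g x - w * g2 x / 2"
  have "?L = (LINT y|std_normal_distribution. ?f y)"
    using m prob_space by (simp add: gauss_def)
  then have "\<bar>?L\<bar> \<le> (LINT y|std_normal_distribution. \<bar>?f y\<bar>)"
    by (simp only: integral_abs_bound)
  also have "\<dots> \<le> (LINT y|std_normal_distribution. (M * (w * sqrt w)) * \<bar>y\<bar> ^ 3)"
  proof (rule integral_mono)
    fix y
    have "sqrt w ^ 3 = w * sqrt w"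
      using \<open>w \<ge> 0\<close> by (simp add: power3_eq_cube)
    then have "\<bar>sqrt w * y\<bar> ^ 3 = w * sqrt w * \<bar>y\<bar> ^ 3"
      using \<open>w \<ge> 0\<close> by (simp add: abs_mult power_mult_distrib)
    then show "\<bar>?f y\<bar> \<le> (M * (w * sqrt w)) * \<bar>y\<bar> ^ 3"
      using *[of x "sqrt w * y"] \<open>w \<ge> 0\<close> by (simp add: power_mult_distrib algebra_simps)
  qed (use m integrable_std_normal_cubed in auto)
  also have "\<dots> = (M * (w * sqrt w)) * (LINT y|std_normal_distribution. \<bar>y\<bar> ^ 3)" by simp
  also have "\<dots> \<le> (M * (w * sqrt w)) * 2"
    using M assms(2) by (intro mult_left_mono integral_std_normal_cubed_le) auto
  finally show ?thesis by (simp add: ac_simps)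
qed

section \<open>The semigroup property of Gaussian averages\<close>

lemma gauss_zero [simp]: "gauss 0 g x = g x"
  using prob_space.prob_space[OF prob_space_std_normal] by (simp add: gauss_def)

lemma normal_density_scale:
  "w > 0 \<Longrightarrow> sqrt w * normal_density 0 (sqrt w) (sqrt w * y) = std_normal_density y"
  by (simp add: normal_density_def real_sqrt_mult power_mult_distrib)

text \<open>Substitution \<open>z = sqrt w * y\<close>; the density form is the one in which facts
  about sums of independent normal variables are phrased.\<close>

lemma gauss_eq_normal_density:
  assumes "g \<in> borel_measurable borel" "w > 0"
  shows "gauss w g x = (LINT z|lborel. normal_density 0 (sqrt w) z * g (x + z))"
proof -
  note [measurable] = assms(1)
  have "(LINT z|lborel. normal_density 0 (sqrt w) z * g (x + z))
      = \<bar>sqrt w\<bar> *\<^sub>R (LINT y|lborel. normal_density 0 (sqrt w) (0 + sqrt w * y) * g (x + (0 + sqrt w * y)))"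
    using assms(2) by (intro lborel_integral_real_affine) auto
  also have "\<dots> = (LINT y|lborel. std_normal_density y * g (x + sqrt w * y))"
    using assms(2) by (simp add: normal_density_scale flip: integral_mult_right_zero mult.assoc)
  also have "\<dots> = gauss w g x"
    unfolding gauss_def by (subst integral_density) auto
  finally show ?thesis ..
qed

lemma integrable_normal_density_cubic_growth:
  assumes "cubic_growth g" "w > 0"
  shows "integrable lborel (\<lambda>z. normal_density 0 (sqrt w) z * g (x + z))"
proof -
  have [measurable]: "g \<in> borel_measurable borel" using assms by (simp add: cubic_growth_def)
  have "integrable lborel (\<lambda>y. std_normal_density y * g (x + sqrt w * y))"
    using integrable_cubic_growth[OF assms(1), of x "sqrt w"] by (subst (asm) integrable_density) auto
  then have "integrable lborel (\<lambda>y. sqrt w * (normal_density 0 (sqrt w) (0 + sqrt w * y) * g (x + (0 + sqrt w * y))))"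
    using assms(2) by (simp add: normal_density_scale flip: mult.assoc)
  then show ?thesis
    using assms(2) lborel_integrable_real_affine_iff[of "sqrt w" "\<lambda>z. normal_density 0 (sqrt w) z * g (x + z)" 0]
    by simp
qed

text \<open>A concrete pair of independent standard normal variables, the coordinates of the product
  space, to which the addition theorem for normal laws can be applied.\<close>

lemma distributed_std_normal_pair:
  defines "P \<equiv> std_normal_distribution \<Otimes>\<^sub>M std_normal_distribution"
  shows "distributed P lborel fst std_normal_density" "distributed P lborel snd std_normal_density"
    and "prob_space.indep_var P borel fst borel snd"
proof -
  let ?N = std_normal_distribution
  interpret N: prob_space ?N by (rule prob_space_std_normal)
  interpret P: pair_prob_space ?N ?N by unfold_locales
  have d1: "distr P borel fst = ?N"
    using N.distr_pair_fst[of ?N] unfolding P_def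
    by (simp cong: distr_cong)
  have d2: "distr P borel snd = ?N"
  proof (rule measure_eqI)
    fix A :: "real set" assume "A \<in> sets (distr P borel snd)"
    then have [measurable]: "A \<in> sets borel" by simp
    have "emeasure (distr P borel snd) A = emeasure P (space ?N \<times> A)"
      by (subst emeasure_distr)
        (auto simp: P_def space_pair_measure intro!: arg_cong2[where f = emeasure])
    also have "\<dots> = emeasure ?N A"
      unfolding P_def using N.emeasure_space_1 by (subst N.emeasure_pair_measure_Times) auto
    finally show "emeasure (distr P borel snd) A = emeasure ?N A" .
  qed simp
  have l: "distr P lborel X = distr P borel X" for X :: "real \<times> real \<Rightarrow> real"
    by (intro distr_cong) auto
  show "distributed P lborel fst std_normal_density" "distributed P lborel snd std_normal_density"
    unfolding distributed_def l d1 d2 by (auto simp: P_def)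
  have "distr P (borel \<Otimes>\<^sub>M borel) (\<lambda>x. (fst x, snd x)) = P"
  proof -
    have "distr P (borel \<Otimes>\<^sub>M borel) (\<lambda>x. (fst x, snd x)) = distr P P (\<lambda>x. x)"
      by (intro distr_cong) (auto simp: P_def intro!: sets_pair_measure_cong)
    then show ?thesis by simp
  qed
  with d1 d2 show "prob_space.indep_var P borel fst borel snd"
    unfolding P_def P.indep_var_distribution_eq by simp
qed

text \<open>The sum of independent centred normal variables of variances \<open>u\<close> and
  \<open>w\<close> is normal with variance \<open>u + w\<close>; Fubini splits its expectation into
  two successive averages.\<close>

lemma gauss_gauss:
  assumes g: "cubic_growth g" and "u \<ge> 0" "w \<ge> 0"
  shows "gauss u (gauss w g) x = gauss (u + w) g x"
\<comment> \<open>A zero variance has no density, so the degenerate cases are treated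
  directly.\<close>
proof (cases "u = 0 \<or> w = 0")
  case True
  then show ?thesis
  proof
    assume "w = 0"
    then show ?thesis by (simp add: gauss_def[of u])
  qed simp
next
  case False
  with assms have uw: "u > 0" "w > 0" by auto
  have [measurable]: "g \<in> borel_measurable borel" using g by (simp add: cubic_growth_def)
  let ?N = std_normal_distribution
  interpret N: prob_space ?N by (rule prob_space_std_normal)
  interpret P: pair_prob_space ?N ?N by unfold_locales
  let ?P = "?N \<Otimes>\<^sub>M ?N"
  note D1 = distributed_std_normal_pair(1) and D2 = distributed_std_normal_pair(2)
    and ind = distributed_std_normal_pair(3)
  have ind': "P.indep_var borel (\<lambda>z. sqrt u * fst z) borel (\<lambda>z. sqrt w * snd z)"
    using P.indep_var_compose[OF ind, of "(*) (sqrt u)" borel "(*) (sqrt w)" borel] by (simp add: comp_def)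
  have D: "distributed ?P lborel (\<lambda>z. sqrt u * fst z + sqrt w * snd z) (normal_density 0 (sqrt (u + w)))"
    using P.add_indep_normal[OF ind', of "sqrt u" "sqrt w" 0 0]
      P.normal_density_affine[OF D1, of "sqrt u" 0] P.normal_density_affine[OF D2, of "sqrt w" 0] uw
    by simp
  have "gauss (u + w) g x = (LINT z|lborel. normal_density 0 (sqrt (u + w)) z * g (x + z))"
    using uw by (intro gauss_eq_normal_density) auto
  also have "\<dots> = (LINT z|?P. g (x + (sqrt u * fst z + sqrt w * snd z)))"
    using distributed_integral[OF D, of "\<lambda>z. g (x + z)"] by simp
  also have "\<dots> = (LINT y|?N. LINT z|?N. g (x + (sqrt u * y + sqrt w * z)))"
  proof -
    have "integrable ?P (\<lambda>z. g (x + (sqrt u * fst z + sqrt w * snd z)))"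
      using distributed_integrable[OF D, of "\<lambda>z. g (x + z)"] uw
        integrable_normal_density_cubic_growth[OF g, of "u + w" x] by simp
    from P.integral_fst'[OF this] show ?thesis by simp
  qed
  also have "\<dots> = gauss u (gauss w g) x"
    by (simp add: gauss_def add.assoc)
  finally show ?thesis ..
qed

subsection \<open>Adding \<open>r\<close> to a uniformly random number\<close>

lemma sum_block_shift: "(\<Sum>n\<in>{a * p..<a * p + p}. f n) = (\<Sum>m<p. f (m + p * a))" for a p :: nat
  using sum.shift_bounds_nat_ivl[of f 0 "a * p" p]
  by (simp add: lessThan_atLeast0 add.commute mult.commute)

locale base_addition =
  fixes b r :: nat
  assumes b: "b \<ge> 2"
begin

text \<open>Expectation when the \<open>k\<close> lowest digits are independent and uniform.\<close>

definition avg :: "nat \<Rightarrow> (nat \<Rightarrow> real) \<Rightarrow> real" where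
  "avg k f = (\<Sum>n<b ^ k. f n) / real b ^ k"

definition carry :: "nat \<Rightarrow> nat \<Rightarrow> nat" where
  "carry k n = (n mod b ^ k + r mod b ^ k) div b ^ k"

definition digit :: "nat \<Rightarrow> nat" where
  "digit k = r div b ^ k mod b"

text \<open>The martingale after \<open>k\<close> digits. Reduction modulo \<open>b ^ k\<close>
  drops the carry out of the top position, so only the digits of \<open>n\<close> and
  \<open>r\<close> below position \<open>k\<close> enter.\<close>

definition walk :: "nat \<Rightarrow> nat \<Rightarrow> int" where
  "walk k n = int (digsum b ((n + r) mod b ^ k)) - int (digsum b (n mod b ^ k))"

text \<open>The \<open>q\<close> of the digit step. The value \<open>b\<close> does occur, when a
  digit \<open>b - 1\<close> of \<open>r\<close> meets a carry; the step is then 0 and the carry is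
  passed on with certainty.\<close>

definition addend :: "nat \<Rightarrow> nat \<Rightarrow> nat" where
  "addend k n = digit k + carry k n"

lemma b_pos [simp]: "b > 0" "b \<noteq> 0" "0 < b ^ k" "0 < real b"
  using b by auto

section \<open>Digit sums and addition with carry\<close>

lemma digsum_0 [simp]: "digsum b 0 = 0"
  by (simp add: digsum_def digits.simps)

lemma digsum_rec: "digsum b n = n mod b + digsum b (n div b)"
  using b by (cases "n = 0") (simp_all add: digsum_def digits.simps[of b n])

lemma digsum_small: "a < b \<Longrightarrow> digsum b a = a"
  by (subst digsum_rec) simp

text \<open>The digits of \<open>m\<close> occupy the \<open>k\<close> lowest positions and those of
  \<open>a\<close> the higher ones, so the two expansions are concatenated.\<close>

lemma digsum_add:
  assumes "m < b ^ k"
  shows "digsum b (m + b ^ k * a) = digsum b m + digsum b a"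
  using assms
proof (induction k arbitrary: m)
  case (Suc k)
  have 1: "m div b < b ^ k"
    using Suc.prems by (simp add: less_mult_imp_div_less mult.commute)
  have "digsum b (m + b ^ Suc k * a) = (m + b * (b ^ k * a)) mod b + digsum b ((m + b * (b ^ k * a)) div b)"
    by (subst digsum_rec) (simp add: mult.assoc)
  also have "\<dots> = m mod b + digsum b (m div b + b ^ k * a)"
    by (simp add: add.commute)
  also have "\<dots> = digsum b m + digsum b a"
    using Suc.IH[OF 1] digsum_rec[of m] by simp
  finally show ?case .
qed simp

lemma digsum_le: "m < b ^ k \<Longrightarrow> digsum b m \<le> b * k"
proof (induction k arbitrary: m)
  case (Suc k)
  have "m div b < b ^ k"
    using Suc.prems by (simp add: less_mult_imp_div_less mult.commute)
  moreover have "m mod b \<le> b" by (simp add: less_imp_le)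
  ultimately show ?case
    using Suc.IH[of "m div b"] digsum_rec[of m] unfolding mult_Suc_right by linarith
qed simp

lemma walk_le: "\<bar>walk k n\<bar> \<le> int (b * k)"
proof -
  have "digsum b ((n + r) mod b ^ k) \<le> b * k" "digsum b (n mod b ^ k) \<le> b * k"
    by (auto intro!: digsum_le)
  then show ?thesis unfolding walk_def by linarith
qed

lemma walk_0 [simp]: "walk 0 n = 0" and carry_0 [simp]: "carry 0 n = 0"
  by (simp_all add: walk_def carry_def)

lemma carry_le: "carry k n \<le> 1"
proof -
  have "n mod b ^ k + r mod b ^ k < 2 * b ^ k"
    using mod_less_divisor[of "b ^ k" n] mod_less_divisor[of "b ^ k" r] by (simp del: mod_less_divisor)
  then have "carry k n < 2" unfolding carry_def by (subst div_less_iff_less_mult) auto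
  then show ?thesis by simp
qed

lemma carry_cases: "carry k n = 0 \<or> carry k n = 1"
  using carry_le[of k n] by linarith

lemma digit_less: "digit k < b"
  by (simp add: digit_def)

lemma addend_le: "addend k n \<le> b"
  using digit_less[of k] carry_le[of k n] unfolding addend_def by linarith

text \<open>Schoolbook addition at position \<open>k\<close>: the part below contributes a residue
  \<open>y\<close> and a carry, and the new digit \<open>a\<close> of \<open>n\<close> receives
  \<open>addend k m\<close>.\<close>

lemma walk_step:
  assumes "m < b ^ k" "a < b"
  shows "walk (Suc k) (m + b ^ k * a) = walk k m + (int ((a + addend k m) mod b) - int a)"
    and "carry (Suc k) (m + b ^ k * a) = (a + addend k m) div b"
proof -
  let ?p = "b ^ k"
  define y where "y = (m + r) mod ?p"
  have y: "y < ?p" by (simp add: y_def)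
  have "y = (m + r mod ?p) mod ?p" by (simp add: y_def mod_simps)
  \<comment> \<open>Division with remainder by \<open>b ^ k\<close>; the quotient is the carry by
    definition.\<close>
  then have yc: "m + r mod ?p = y + ?p * carry k m"
    using assms(1) by (simp add: carry_def)
  have n: "m + ?p * a < b ^ Suc k"
  proof -
    have "m + ?p * a < ?p * Suc a" using assms(1) by simp
    also have "\<dots> \<le> ?p * b" using assms(2) by (intro mult_left_mono) auto
    finally show ?thesis by (simp add: mult.commute)
  qed
  have r: "r mod b ^ Suc k = ?p * digit k + r mod ?p"
    using mod_mult2_eq[of r ?p b] by (simp add: digit_def mult.commute)
  have s: "m + ?p * a + r mod b ^ Suc k = y + ?p * (a + addend k m)"
    using r yc by (simp add: addend_def algebra_simps)
  have "(m + ?p * a + r) mod b ^ Suc k = (y + ?p * (a + addend k m)) mod (?p * b)"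
    using s by (metis mod_add_right_eq mult.commute power_Suc)
  also have "\<dots> = y + ?p * ((a + addend k m) mod b)"
    using y by (subst mod_mult2_eq) simp
  finally have "digsum b ((m + ?p * a + r) mod b ^ Suc k) = digsum b y + (a + addend k m) mod b"
    using digsum_add[OF y] by (simp add: digsum_small)
  moreover have "digsum b ((m + ?p * a) mod b ^ Suc k) = digsum b m + a"
    using n digsum_add[OF assms(1)] assms(2) by (simp add: digsum_small del: power_Suc)
  ultimately show "walk (Suc k) (m + ?p * a) = walk k m + (int ((a + addend k m) mod b) - int a)"
    using assms(1) by (simp add: walk_def y_def del: power_Suc)
  have "carry (Suc k) (m + ?p * a) = (y + ?p * (a + addend k m)) div (?p * b)"
    using n s by (simp add: carry_def mult.commute)
  also have "\<dots> = (a + addend k m) div b"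
    using y by (subst div_mult2_eq) simp
  finally show "carry (Suc k) (m + ?p * a) = (a + addend k m) div b" .
qed

section \<open>Averages over uniform digits and the transition rule\<close>

lemma avg_0 [simp]: "avg 0 f = f 0"
  by (simp add: avg_def)

lemma avg_const [simp]: "avg k (\<lambda>_. c) = c"
  by (simp add: avg_def)

lemma avg_add: "avg k (\<lambda>n. f n + g n) = avg k f + avg k g"
  by (simp add: avg_def sum.distrib add_divide_distrib)

lemma avg_diff: "avg k (\<lambda>n. f n - g n) = avg k f - avg k g"
  by (simp add: avg_def sum_subtractf diff_divide_distrib)

lemma avg_cmult: "avg k (\<lambda>n. c * f n) = c * avg k f"
  by (simp add: avg_def sum_distrib_left)

lemma avg_cong: "(\<And>n. n < b ^ k \<Longrightarrow> f n = g n) \<Longrightarrow> avg k f = avg k g"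
  by (simp add: avg_def)

lemma avg_mono: "(\<And>n. n < b ^ k \<Longrightarrow> f n \<le> g n) \<Longrightarrow> avg k f \<le> avg k g"
  by (auto simp: avg_def intro!: divide_right_mono sum_mono)

lemma avg_nonneg: "(\<And>n. n < b ^ k \<Longrightarrow> 0 \<le> f n) \<Longrightarrow> 0 \<le> avg k f"
  by (auto simp: avg_def intro!: divide_nonneg_nonneg sum_nonneg)

lemma abs_avg_le: "\<bar>avg k f\<bar> \<le> avg k (\<lambda>n. \<bar>f n\<bar>)"
  by (simp add: avg_def divide_right_mono)

lemma avg_sum: "avg k (\<lambda>n. \<Sum>i\<in>I. f i n) = (\<Sum>i\<in>I. avg k (f i))"
  unfolding avg_def by (subst sum.swap) (simp add: sum_divide_distrib)

text \<open>Conditioning on the \<open>k\<close> lowest digits: the new top digit \<open>a\<close>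
  is uniform and indexes consecutive blocks of length \<open>b ^ k\<close>.\<close>

lemma avg_Suc: "avg (Suc k) f = avg k (\<lambda>m. (\<Sum>a<b. f (m + b ^ k * a)) / real b)"
proof -
  have "(\<Sum>n<b ^ Suc k. f n) = (\<Sum>a<b. \<Sum>n\<in>{a * b ^ k..<a * b ^ k + b ^ k}. f n)"
    using sum.nat_group[of f "b ^ k" b] by simp
  also have "\<dots> = (\<Sum>a<b. \<Sum>m<b ^ k. f (m + b ^ k * a))"
    by (simp only: sum_block_shift)
  also have "\<dots> = (\<Sum>m<b ^ k. \<Sum>a<b. f (m + b ^ k * a))"
    by (rule sum.swap)
  finally show ?thesis
    by (simp add: avg_def sum_divide_distrib)
qed

text \<open>The \<open>b - q\<close> digits below \<open>b - q\<close> produce no carry and change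
  by \<open>q\<close>; the other \<open>q\<close> digits wrap around and change by
  \<open>q - b\<close>.\<close>

lemma sum_digit_step:
  assumes "q \<le> b"
  shows "(\<Sum>a<b. \<phi> (int ((a + q) mod b) - int a) ((a + q) div b))
       = (real b - real q) * \<phi> (int q) 0 + real q * \<phi> (int q - int b) (1::nat)"
proof -
  let ?f = "\<lambda>a. \<phi> (int ((a + q) mod b) - int a) ((a + q) div b)"
  have "sum ?f {..<b} = sum ?f {..<b - q} + sum ?f {b - q..<b}"
    using assms by (subst sum.union_disjoint[symmetric]) (auto intro!: sum.cong)
  also have "sum ?f {..<b - q} = (\<Sum>a<b - q. \<phi> (int q) 0)"
    by (intro sum.cong refl) auto
  also have "sum ?f {b - q..<b} = (\<Sum>a\<in>{b - q..<b}. \<phi> (int q - int b) 1)"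
  proof (intro sum.cong refl)
    fix a assume a: "a \<in> {b - q..<b}"
    have 1: "(a + q) div b = 1" using a assms by (intro div_nat_eqI) auto
    have "(a + q) mod b = a + q - b"
      using 1 div_mult_mod_eq[of "a + q" b] by simp
    then have "int ((a + q) mod b) - int a = int q - int b" using a assms by auto
    with 1 show "?f a = \<phi> (int q - int b) 1" by simp
  qed
  finally show ?thesis using assms by (simp add: of_nat_diff)
qed

text \<open>The transition rule of the Markov chain formed by walk and carry. All moment and
  correlation estimates below are instances for suitable test functions
  \<open>\<phi>\<close>.\<close>

lemma avg_step:
  "avg (Suc k) (\<lambda>n. \<phi> (walk (Suc k) n) (carry (Suc k) n)) =
   avg k (\<lambda>m. ((real b - real (addend k m)) * \<phi> (walk k m + int (addend k m)) 0
               + real (addend k m) * \<phi> (walk k m + int (addend k m) - int b) 1) / real b)"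
  unfolding avg_Suc
proof (rule avg_cong)
  fix m assume m: "m < b ^ k"
  have "(\<Sum>a<b. \<phi> (walk (Suc k) (m + b ^ k * a)) (carry (Suc k) (m + b ^ k * a)))
      = (\<Sum>a<b. \<phi> (walk k m + (int ((a + addend k m) mod b) - int a)) ((a + addend k m) div b))"
    by (intro sum.cong refl) (simp add: walk_step[OF m])
  also have "\<dots> = (real b - real (addend k m)) * \<phi> (walk k m + int (addend k m)) 0
               + real (addend k m) * \<phi> (walk k m + int (addend k m) - int b) 1"
    using sum_digit_step[OF addend_le, where \<phi> = "\<lambda>x. \<phi> (walk k m + x)"] by (simp add: add_diff_eq)
  finally show "(\<Sum>a<b. \<phi> (walk (Suc k) (m + b ^ k * a)) (carry (Suc k) (m + b ^ k * a))) / real b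
     = ((real b - real (addend k m)) * \<phi> (walk k m + int (addend k m)) 0
               + real (addend k m) * \<phi> (walk k m + int (addend k m) - int b) 1) / real b" by simp
qed

section \<open>First and second moments of the walk\<close>

definition step_var :: "nat \<Rightarrow> real" where
  "step_var k = avg k (\<lambda>n. real (addend k n) * (real b - real (addend k n)))"

definition carry_mean :: "nat \<Rightarrow> real" where
  "carry_mean k = avg k (\<lambda>n. real (carry k n))"

lemma addend_var_nonneg: "0 \<le> real (addend k n) * (real b - real (addend k n))"
  using addend_le[of k n] by simp

lemma step_var_nonneg: "0 \<le> step_var k"
  unfolding step_var_def by (intro avg_nonneg addend_var_nonneg)

lemma carry_mean_0 [simp]: "carry_mean 0 = 0"
  by (simp add: carry_mean_def)

text \<open>Given the lower digits, a carry leaves position \<open>k\<close> with probability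
  \<open>addend k m / b\<close>.\<close>

lemma carry_mean_Suc: "carry_mean (Suc k) = (real (digit k) + carry_mean k) / real b"
proof -
  have "carry_mean (Suc k) = avg k (\<lambda>m. (1 / real b) * (real (digit k) + real (carry k m)))"
    unfolding carry_mean_def using avg_step[where k = k and \<phi> = "\<lambda>_ c. real c"] by (simp add: addend_def)
  then show ?thesis unfolding avg_cmult avg_add by (simp add: carry_mean_def)
qed

lemma carry_mean_bounds: "0 \<le> carry_mean k" "carry_mean k \<le> 1"
proof -
  show "0 \<le> carry_mean k" unfolding carry_mean_def by (intro avg_nonneg) auto
  have "carry_mean k \<le> avg k (\<lambda>_. 1)" unfolding carry_mean_def using carry_le by (intro avg_mono) (metis of_nat_le_1_iff)
  then show "carry_mean k \<le> 1" by simp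
qed

text \<open>The carry only takes the values 0 and 1, so every function of it is affine. The
  fluctuation of the conditional variance is therefore a multiple of the centred carry.\<close>

lemma addend_var_affine:
  "real (addend k n) * (real b - real (addend k n)) =
    real (digit k) * (real b - real (digit k)) + (real b - 1 - 2 * real (digit k)) * real (carry k n)"
  using carry_cases[of k n] by (auto simp: addend_def algebra_simps)

lemma step_var_eq: "step_var k = real (digit k) * (real b - real (digit k)) + (real b - 1 - 2 * real (digit k)) * carry_mean k"
  unfolding step_var_def addend_var_affine avg_add avg_cmult carry_mean_def by simp

text \<open>The two outcomes \<open>q\<close> and \<open>q - b\<close>, weighted by
  \<open>b - q\<close> and \<open>q\<close>, cancel: each step has conditional mean 0.\<close>

lemma avg_walk: "avg k (\<lambda>n. real_of_int (walk k n)) = 0"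
proof (induction k)
  case (Suc k)
  have "avg (Suc k) (\<lambda>n. real_of_int (walk (Suc k) n)) = avg k (\<lambda>n. real_of_int (walk k n))"
    unfolding avg_step[where \<phi> = "\<lambda>d _. real_of_int d"]
    by (intro avg_cong) (simp add: field_simps)
  with Suc show ?case by simp
qed simp

text \<open>Orthogonality of martingale increments: the cross term drops out and the conditional
  second moment of the step is \<open>q * (b - q)\<close>.\<close>

lemma avg_walk_sq: "avg k (\<lambda>n. (real_of_int (walk k n))\<^sup>2) = (\<Sum>j<k. step_var j)"
proof (induction k)
  case (Suc k)
  have "avg (Suc k) (\<lambda>n. (real_of_int (walk (Suc k) n))\<^sup>2) =
      avg k (\<lambda>n. (real_of_int (walk k n))\<^sup>2 + real (addend k n) * (real b - real (addend k n)))"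
    unfolding avg_step[where \<phi> = "\<lambda>d _. (real_of_int d)\<^sup>2"]
    by (intro avg_cong) (simp add: field_simps power2_eq_square)
  with Suc show ?case by (simp add: avg_add step_var_def)
qed simp

subsection \<open>The law of the digit sum difference\<close>

definition growth_bound :: "nat \<Rightarrow> real" where
  "growth_bound k = 1 + (real b * real k) ^ 3"

lemma growth_bound_walk: "1 + \<bar>real_of_int (walk k n)\<bar> ^ 3 \<le> growth_bound k"
proof -
  have "real_of_int \<bar>walk k n\<bar> \<le> real_of_int (int (b * k))" using walk_le of_int_le_iff by blast
  then show ?thesis unfolding growth_bound_def by (intro add_left_mono power_mono) auto
qed

lemma Delta_eq_walk: "n + r < b ^ k \<Longrightarrow> Delta b r n = walk k n"
  by (simp add: Delta_def walk_def)

text \<open>No carry reaches position \<open>k\<close>, so the digits of \<open>a\<close> agree in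
  both numbers and cancel.\<close>

lemma Delta_shift:
  assumes "n + r < b ^ k"
  shows "Delta b r (n + b ^ k * a) = Delta b r n"
proof -
  have "digsum b (n + b ^ k * a + r) = digsum b (n + r) + digsum b a"
    using digsum_add[OF assms] by (simp add: ac_simps)
  moreover have "digsum b (n + b ^ k * a) = digsum b n + digsum b a"
    using assms by (intro digsum_add) simp
  ultimately show ?thesis by (simp add: Delta_def)
qed

lemma shift_less:
  assumes "n + r < b ^ k" "a < b"
  shows "n + b ^ k * a + r < b ^ Suc k"
proof -
  have "n + b ^ k * a + r < b ^ k * Suc a" using assms by simp
  also have "\<dots> \<le> b ^ k * b" using assms(2) by (intro mult_left_mono) auto
  finally show ?thesis by (simp add: mult.commute)
qed

text \<open>Only the last \<open>r\<close> residues can overflow; truncated subtraction also covers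
  \<open>r > b ^ k\<close>.\<close>

lemma sum_overflow_le: "(\<Sum>n::nat<b ^ k. of_bool (\<not> n + r < b ^ k)) \<le> real r"
proof -
  have "(\<Sum>n::nat<b ^ k. of_bool (\<not> n + r < b ^ k)) = real (card ({..<b ^ k} \<inter> {n. \<not> n + r < b ^ k}))"
    by (rule sum_of_bool_eq) simp_all
  also have "card ({..<b ^ k} \<inter> {n. \<not> n + r < b ^ k}) \<le> card {b ^ k - r..<b ^ k}"
    by (intro card_mono) auto
  also have "\<dots> \<le> r" by simp
  finally show ?thesis by simp
qed

lemma avg_overflow_le: "avg k (\<lambda>n. of_bool (\<not> n + r < b ^ k)) \<le> real r / real b ^ k"
  unfolding avg_def by (intro divide_right_mono sum_overflow_le) simp

text \<open>Without overflow at position \<open>k\<close>, the higher digits of \<open>n\<close> do not influence \<open>\<Delta>\<close>.\<close>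

definition settled_avg :: "nat \<Rightarrow> (int \<Rightarrow> real) \<Rightarrow> real" where
  "settled_avg k f = avg k (\<lambda>n. of_bool (n + r < b ^ k) * f (Delta b r n))"

text \<open>A settled \<open>n\<close> stays settled with the same value of \<open>Delta\<close>
  whichever digit is put on top, so passing to more digits only adds nonnegative terms.\<close>

lemma settled_avg_mono_Suc:
  assumes "\<And>d. 0 \<le> f d"
  shows "settled_avg k f \<le> settled_avg (Suc k) f"
  unfolding settled_avg_def avg_Suc
proof (rule avg_mono)
  fix n
  have "(\<Sum>a<b. of_bool (n + r < b ^ k) * f (Delta b r n))
      \<le> (\<Sum>a<b. of_bool (n + b ^ k * a + r < b ^ Suc k) * f (Delta b r (n + b ^ k * a)))"
    by (intro sum_mono) (auto simp: Delta_shift assms dest: shift_less)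
  then show "of_bool (n + r < b ^ k) * f (Delta b r n)
      \<le> (\<Sum>a<b. of_bool (n + b ^ k * a + r < b ^ Suc k) * f (Delta b r (n + b ^ k * a))) / real b"
    by (simp add: field_simps)
qed

text \<open>New terms arise only from residues that overflowed at level \<open>k\<close>, a set of
  proportion at most \<open>r / b ^ k\<close>, and there \<open>f\<close> grows polynomially in
  \<open>k\<close>.\<close>

lemma settled_avg_Suc_le:
  assumes "\<And>d. \<bar>f d\<bar> \<le> A * (1 + \<bar>real_of_int d\<bar> ^ 3)" "A \<ge> 0"
  shows "settled_avg (Suc k) f \<le> settled_avg k f + A * growth_bound (Suc k) * (real r / real b ^ k)"
proof -
  let ?U = "A * growth_bound (Suc k)"
  have U: "\<bar>f (walk (Suc k) n)\<bar> \<le> ?U" for n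
    using assms(1)[of "walk (Suc k) n"] growth_bound_walk[of "Suc k" n] assms(2)
    by (meson mult_left_mono order_trans)
  have U0: "0 \<le> ?U" using assms(2) by (auto simp: growth_bound_def)
  have "settled_avg (Suc k) f \<le> avg k (\<lambda>n. of_bool (n + r < b ^ k) * f (Delta b r n) + ?U * of_bool (\<not> n + r < b ^ k))"
    unfolding settled_avg_def avg_Suc
  proof (rule avg_mono)
    fix n
    let ?x = "of_bool (n + r < b ^ k) * f (Delta b r n) + ?U * of_bool (\<not> n + r < b ^ k)"
    have "(\<Sum>a<b. of_bool (n + b ^ k * a + r < b ^ Suc k) * f (Delta b r (n + b ^ k * a))) \<le> (\<Sum>a<b. ?x)"
    proof (rule sum_mono)
      fix a assume a: "a \<in> {..<b}"
      show "of_bool (n + b ^ k * a + r < b ^ Suc k) * f (Delta b r (n + b ^ k * a)) \<le> ?x"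
      proof (cases "n + r < b ^ k")
        case True
        then show ?thesis using a shift_less[of n k a] Delta_shift[OF True] by auto
      next
        case False
        then show ?thesis using U[of "n + b ^ k * a"] U0 Delta_eq_walk[of "n + b ^ k * a" "Suc k"]
          by (auto simp del: power_Suc simp: abs_le_iff)
      qed
    qed
    then show "(\<Sum>a<b. of_bool (n + b ^ k * a + r < b ^ Suc k) * f (Delta b r (n + b ^ k * a))) / real b \<le> ?x"
      by (simp add: field_simps)
  qed
  also have "\<dots> = settled_avg k f + ?U * avg k (\<lambda>n. of_bool (\<not> n + r < b ^ k))"
    unfolding avg_add avg_cmult settled_avg_def ..
  also have "\<dots> \<le> settled_avg k f + ?U * (real r / real b ^ k)"
    by (intro add_left_mono mult_left_mono avg_overflow_le U0)
  finally show ?thesis .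
qed

text \<open>A cubic polynomial against a geometric sequence. Comparison with powers of 2 reduces the
  asymptotics to a fixed base.\<close>

lemma growth_bound_summable: "summable (\<lambda>k. growth_bound (Suc k) / real b ^ k)"
proof (rule summable_comparison_test)
  show "\<exists>N. \<forall>k\<ge>N. norm (growth_bound (Suc k) / real b ^ k) \<le> growth_bound (Suc k) / 2 ^ k"
    using b by (auto simp: growth_bound_def intro!: divide_left_mono power_mono)
  show "summable (\<lambda>k. growth_bound (Suc k) / 2 ^ k)"
  proof (rule summable_comparison_test_bigo)
    have "(\<lambda>k. (1 + (B * (real k + 1)) ^ 3) / 2 ^ k) \<in> O(\<lambda>k. inverse (real k ^ 2))" if "B > 0" for B
      using that by real_asymp
    from this[of "real b"] show "(\<lambda>k. growth_bound (Suc k) / 2 ^ k) \<in> O(\<lambda>k. inverse (real k ^ 2))"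
      by (simp add: growth_bound_def add.commute)
  qed (auto intro: inverse_power_summable)
qed

lemma settled_avg_bounded:
  assumes "\<And>d. \<bar>f d\<bar> \<le> A * (1 + \<bar>real_of_int d\<bar> ^ 3)" "A \<ge> 0"
  shows "settled_avg k f \<le> settled_avg 0 f + A * real r * (\<Sum>k. growth_bound (Suc k) / real b ^ k)"
proof -
  let ?g = "\<lambda>k. growth_bound (Suc k) / real b ^ k"
  have "settled_avg k f \<le> settled_avg 0 f + A * real r * (\<Sum>j<k. ?g j)"
  proof (induction k)
    case (Suc k)
    show ?case using Suc settled_avg_Suc_le[OF assms, of k] by (simp add: algebra_simps)
  qed simp
  also have "(\<Sum>j<k. ?g j) \<le> suminf ?g"
    by (intro sum_le_suminf growth_bound_summable) (auto simp: growth_bound_def)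
  then have "settled_avg 0 f + A * real r * (\<Sum>j<k. ?g j) \<le> settled_avg 0 f + A * real r * suminf ?g"
    using assms(2) by (intro add_left_mono mult_left_mono) auto
  finally show ?thesis .
qed

text \<open>An increasing sequence, bounded because its increments are dominated by a summable
  sequence.\<close>

lemma settled_avg_convergent:
  assumes "\<And>d. \<bar>f d\<bar> \<le> A * (1 + \<bar>real_of_int d\<bar> ^ 3)" "A \<ge> 0" "\<And>d. 0 \<le> f d"
  obtains S where "(\<lambda>k. settled_avg k f) \<longlonglongrightarrow> S" "\<And>k. settled_avg k f \<le> S"
proof -
  have "incseq (\<lambda>k. settled_avg k f)" by (intro incseq_SucI settled_avg_mono_Suc assms)
  then show ?thesis
    using settled_avg_bounded[OF assms(1,2)] incseq_convergent[of "\<lambda>k. settled_avg k f"] that by blast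
qed

section \<open>Existence of the limiting frequencies\<close>

text \<open>Cut the range below \<open>N\<close> into blocks of length \<open>b ^ k\<close>. In each
  full block the settled residues have fixed values of \<open>Delta\<close> and at most
  \<open>r\<close> residues are undecided; the incomplete block costs at most
  \<open>p\<close>.\<close>

lemma count_Delta_bounds:
  fixes d :: int and N k :: nat
  defines "p \<equiv> real b ^ k" and "g \<equiv> settled_avg k (\<lambda>x. of_bool (x = d))"
  shows "real N * g - p \<le> real (card {n. n < N \<and> Delta b r n = d})"
    and "real (card {n. n < N \<and> Delta b r n = d}) \<le> real N * g + real N * (real r / p) + p"
proof -
  let ?P = "\<lambda>n. of_bool (Delta b r n = d) :: real"
  let ?G = "\<Sum>n<b ^ k. of_bool (n + r < b ^ k) * ?P n"
  have G: "?G = g * p" by (simp add: g_def p_def settled_avg_def avg_def)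
  have p: "p > 0" by (simp add: p_def)
  have cnt: "real (card {n. n < N \<and> Delta b r n = d}) = (\<Sum>n<N. ?P n)" for N
  proof -
    have "{n. n < N \<and> Delta b r n = d} = {..<N} \<inter> {n. Delta b r n = d}" by auto
    then show ?thesis by (simp only: sum_of_bool_eq[OF finite_lessThan finite_lessThan])
  qed
  have blk: "?G \<le> (\<Sum>n\<in>{i * b ^ k..<i * b ^ k + b ^ k}. ?P n)"
    "(\<Sum>n\<in>{i * b ^ k..<i * b ^ k + b ^ k}. ?P n) \<le> ?G + real r" for i
  proof -
    have eq: "(\<Sum>n\<in>{i * b ^ k..<i * b ^ k + b ^ k}. ?P n) = (\<Sum>n<b ^ k. ?P (n + b ^ k * i))"
      by (rule sum_block_shift)
    show "?G \<le> (\<Sum>n\<in>{i * b ^ k..<i * b ^ k + b ^ k}. ?P n)"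
      unfolding eq by (intro sum_mono) (auto simp: Delta_shift)
    have "(\<Sum>n<b ^ k. ?P (n + b ^ k * i)) \<le> (\<Sum>n<b ^ k. of_bool (n + r < b ^ k) * ?P n + of_bool (\<not> n + r < b ^ k))"
      by (intro sum_mono) (auto simp: Delta_shift)
    also have "\<dots> \<le> ?G + real r"
      unfolding sum.distrib by (intro add_left_mono sum_overflow_le)
    finally show "(\<Sum>n\<in>{i * b ^ k..<i * b ^ k + b ^ k}. ?P n) \<le> ?G + real r" unfolding eq .
  qed
  have grp: "(\<Sum>n<m * b ^ k. ?P n) = (\<Sum>i<m. \<Sum>n\<in>{i * b ^ k..<i * b ^ k + b ^ k}. ?P n)" for m
    by (rule sum.nat_group[symmetric])
  have g0: "0 \<le> g" "g \<le> 1"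
  proof -
    show "0 \<le> g" unfolding g_def settled_avg_def by (intro avg_nonneg) auto
    have "g \<le> avg k (\<lambda>_. 1)" unfolding g_def settled_avg_def by (intro avg_mono) auto
    then show "g \<le> 1" by simp
  qed
  define m where "m = N div b ^ k"
  have m1: "m * b ^ k \<le> N" "N \<le> Suc m * b ^ k"
    using div_times_less_eq_dividend[of N "b ^ k"] dividend_less_div_times[of "b ^ k" N]
    by (simp_all add: m_def less_imp_le)
  have m2: "real m * p \<le> real N" "real N \<le> (real m + 1) * p"
    using m1[THEN of_nat_mono[where 'a = real]] by (simp_all add: p_def algebra_simps)
  \<comment> \<open>The range is extended to the next full block; the surplus \<open>p * g\<close>
    is at most \<open>p\<close> because \<open>g\<close> is a proportion.\<close>
  have "real N * g \<le> (real m + 1) * p * g"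
    using m2 g0 by (intro mult_right_mono) auto
  also have "\<dots> \<le> real m * (g * p) + p"
    using mult_left_mono[OF g0(2), of p] p by (simp add: algebra_simps)
  also have "real m * (g * p) \<le> (\<Sum>n<m * b ^ k. ?P n)"
    unfolding grp using sum_mono[of "{..<m}" "\<lambda>_. ?G", OF blk(1)] by (simp add: G)
  also have "\<dots> \<le> (\<Sum>n<N. ?P n)"
    using m1 by (intro sum_mono2) auto
  finally show "real N * g - p \<le> real (card {n. n < N \<and> Delta b r n = d})"
    unfolding cnt by simp
  have "(\<Sum>n<N. ?P n) \<le> (\<Sum>n<m * b ^ k. ?P n) + (\<Sum>n\<in>{m * b ^ k..<m * b ^ k + b ^ k}. ?P n)"
  proof -
    have "(\<Sum>n<N. ?P n) \<le> (\<Sum>n\<in>{..<m * b ^ k} \<union> {m * b ^ k..<m * b ^ k + b ^ k}. ?P n)"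
      using m1 by (intro sum_mono2) auto
    also have "\<dots> = (\<Sum>n<m * b ^ k. ?P n) + (\<Sum>n\<in>{m * b ^ k..<m * b ^ k + b ^ k}. ?P n)"
      by (intro sum.union_disjoint) auto
    finally show ?thesis .
  qed
  also have "(\<Sum>n\<in>{m * b ^ k..<m * b ^ k + b ^ k}. ?P n) \<le> (\<Sum>n\<in>{m * b ^ k..<m * b ^ k + b ^ k}. 1)"
    by (intro sum_mono) auto
  also have "\<dots> = p" by (simp add: p_def)
  also have "(\<Sum>n<m * b ^ k. ?P n) \<le> real m * (g * p + real r)"
    unfolding grp using sum_mono[of "{..<m}" _ "\<lambda>_. ?G + real r", OF blk(2)] by (simp add: G)
  also have "real m * (g * p + real r) = (real m * p) * (g + real r / p)"
    using p by (simp add: field_simps)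
  also have "\<dots> \<le> real N * (g + real r / p)"
    using m2 g0 p by (intro mult_right_mono) auto
  finally show "real (card {n. n < N \<and> Delta b r n = d}) \<le> real N * g + real N * (real r / p) + p"
    unfolding cnt by (simp add: algebra_simps)
qed

lemma overflow_tendsto: "(\<lambda>k. c * growth_bound (Suc k) * (real r / real b ^ k)) \<longlonglongrightarrow> 0"
  using tendsto_mult_right_zero[OF summable_LIMSEQ_zero[OF growth_bound_summable], of "c * real r"]
  by (simp add: ac_simps)

text \<open>\<open>mu\<close> is a bare \<open>lim\<close>, so convergence of the frequencies has to
  be shown: fix \<open>k\<close> first to make the undecided proportion small, then take
  \<open>N\<close> large against the block length.\<close>

lemma settled_avg_indicator_tendsto_mu:
  "(\<lambda>k. settled_avg k (\<lambda>x. of_bool (x = d))) \<longlonglongrightarrow> mu b r d" "settled_avg k (\<lambda>x. of_bool (x = d)) \<le> mu b r d"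
proof -
  let ?g = "\<lambda>k. settled_avg k (\<lambda>x. of_bool (x = d))"
  obtain m where m: "?g \<longlonglongrightarrow> m" "\<And>k. ?g k \<le> m"
    by (rule settled_avg_convergent[of "\<lambda>x. of_bool (x = d)" 1]) auto
  let ?c = "\<lambda>N. real (card {n. n < N \<and> Delta b r n = d}) / real N"
  have "?c \<longlonglongrightarrow> m"
  proof (rule LIMSEQ_I)
    fix e :: real assume e: "e > 0"
    have "(\<lambda>k. real r / real b ^ k) \<longlonglongrightarrow> 0"
      using b by real_asymp
    then have "\<forall>\<^sub>F k in sequentially. real r / real b ^ k < e / 3"
      using e by (intro order_tendstoD) auto
    moreover have "\<forall>\<^sub>F k in sequentially. ?g k > m - e / 3"
      using e m(1) by (intro order_tendstoD) auto
    ultimately obtain k where k: "real r / real b ^ k < e / 3" "?g k > m - e / 3"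
      using eventually_happens[OF eventually_conj] by (metis (no_types, lifting) sequentially_bot)
    \<comment> \<open>Chosen so that the boundary term \<open>b ^ k / N\<close> falls below
      \<open>e / 3\<close>.\<close>
    obtain N0 :: nat where N0: "real N0 > 3 * real b ^ k / e" using reals_Archimedean2 by blast
    show "\<exists>no. \<forall>n\<ge>no. norm (?c n - m) < e"
    proof (intro exI allI impI)
      fix N assume N: "N \<ge> Suc N0"
      then have Np: "real N > 0" by simp
      have "3 * real b ^ k / e < real N" using N0 N by linarith
      then have pN: "real b ^ k / real N < e / 3" using e Np by (simp add: field_simps)
      have "?g k - real b ^ k / real N \<le> ?c N"
        using divide_right_mono[OF count_Delta_bounds(1)[of N k d], of "real N"] Np
        by (simp add: diff_divide_distrib)
      moreover have "?c N \<le> ?g k + real r / real b ^ k + real b ^ k / real N"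
        using divide_right_mono[OF count_Delta_bounds(2)[of N d k], of "real N"] Np
        by (simp add: add_divide_distrib)
      ultimately show "norm (?c N - m) < e"
        using k pN m(2)[of k] unfolding real_norm_def by linarith
    qed
  qed
  then have "mu b r d = m" unfolding mu_def by (rule limI)
  then show "?g \<longlonglongrightarrow> mu b r d" "?g k \<le> mu b r d" using m by auto
qed

lemma mu_nonneg: "0 \<le> mu b r d"
  by (rule order_trans[OF _ settled_avg_indicator_tendsto_mu(2)[of 0 d]]) (auto simp: settled_avg_def intro!: avg_nonneg)

section \<open>Expectations under \<open>mu\<close> as limits of averages over the walk\<close>

lemma settled_avg_eq_sum:
  assumes "finite F" "\<And>n. n + r < b ^ k \<Longrightarrow> Delta b r n \<in> F"
  shows "settled_avg k f = (\<Sum>d\<in>F. settled_avg k (\<lambda>x. of_bool (x = d)) * f d)"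
proof -
  have "(\<Sum>d\<in>F. settled_avg k (\<lambda>x. of_bool (x = d)) * f d)
      = avg k (\<lambda>n. \<Sum>d\<in>F. f d * (of_bool (n + r < b ^ k) * of_bool (Delta b r n = d)))"
    unfolding avg_sum avg_cmult settled_avg_def by (simp add: mult.commute)
  also have "\<dots> = settled_avg k f"
    unfolding settled_avg_def
  proof (rule avg_cong)
    fix n
    show "(\<Sum>d\<in>F. f d * (of_bool (n + r < b ^ k) * of_bool (Delta b r n = d)))
        = of_bool (n + r < b ^ k) * f (Delta b r n)"
      using assms by (cases "n + r < b ^ k") (auto simp: of_bool_def if_distrib sum.delta' cong: if_cong)
  qed
  finally show ?thesis ..
qed

lemma sum_settled_avg_le:
  assumes "finite F" "\<And>d. 0 \<le> f d"
  shows "(\<Sum>d\<in>F. settled_avg k (\<lambda>x. of_bool (x = d)) * f d) \<le> settled_avg k f"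
proof -
  define F' where "F' = F \<union> Delta b r ` {n. n + r < b ^ k}"
  have "finite {n. n + r < b ^ k}" by (rule finite_subset[of _ "{..<b ^ k}"]) auto
  then have F': "finite F'" using assms by (simp add: F'_def)
  have "(\<Sum>d\<in>F. settled_avg k (\<lambda>x. of_bool (x = d)) * f d) \<le> (\<Sum>d\<in>F'. settled_avg k (\<lambda>x. of_bool (x = d)) * f d)"
    using F' assms by (intro sum_mono2) (auto simp: F'_def settled_avg_def intro!: mult_nonneg_nonneg avg_nonneg)
  also have "\<dots> = settled_avg k f"
    using F' by (intro settled_avg_eq_sum[symmetric]) (auto simp: F'_def)
  finally show ?thesis .
qed

text \<open>Monotone convergence by hand: finite sums against \<open>mu\<close> are limits of sums
  bounded by \<open>settled_avg k f\<close>, and conversely each \<open>settled_avg k f\<close> is a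
  finite sum whose weights are below \<open>mu\<close>.\<close>

lemma has_sum_mu_nonneg:
  assumes f: "\<And>d. 0 \<le> f d" and S: "(\<lambda>k. settled_avg k f) \<longlonglongrightarrow> S" "\<And>k. settled_avg k f \<le> S"
  shows "((\<lambda>d. mu b r d * f d) has_sum S) UNIV"
proof -
  have le: "(\<Sum>d\<in>F. mu b r d * f d) \<le> S" if "finite F" for F
  proof (rule LIMSEQ_le)
    show "(\<lambda>k. \<Sum>d\<in>F. settled_avg k (\<lambda>x. of_bool (x = d)) * f d) \<longlonglongrightarrow> (\<Sum>d\<in>F. mu b r d * f d)"
      by (intro tendsto_intros settled_avg_indicator_tendsto_mu)
  qed (use S sum_settled_avg_le[OF that f] in auto)
  have sm: "(\<lambda>d. mu b r d * f d) summable_on UNIV"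
    using le f by (intro nonneg_bdd_above_summable_on bdd_aboveI2[where M = S]) (auto simp: mu_nonneg)
  have "infsum (\<lambda>d. mu b r d * f d) UNIV \<le> S"
    using sm le by (intro infsum_le_finite_sums) auto
  moreover have "S \<le> infsum (\<lambda>d. mu b r d * f d) UNIV"
  proof (rule LIMSEQ_le_const2[OF S(1)], intro exI allI impI)
    fix k
    let ?F = "Delta b r ` {n. n + r < b ^ k}"
    have "finite {n. n + r < b ^ k}" by (rule finite_subset[of _ "{..<b ^ k}"]) auto
    then have F: "finite ?F" by simp
    have "settled_avg k f = (\<Sum>d\<in>?F. settled_avg k (\<lambda>x. of_bool (x = d)) * f d)"
      by (rule settled_avg_eq_sum[OF F]) auto
    also have "\<dots> \<le> (\<Sum>d\<in>?F. mu b r d * f d)"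
      by (intro sum_mono mult_right_mono settled_avg_indicator_tendsto_mu f)
    also have "\<dots> \<le> infsum (\<lambda>d. mu b r d * f d) UNIV"
      using sm F f by (intro finite_sum_le_infsum) (auto simp: mu_nonneg)
    finally show "settled_avg k f \<le> infsum (\<lambda>d. mu b r d * f d) UNIV" .
  qed
  ultimately show ?thesis using sm by (metis has_sum_infsum order_antisym)
qed

text \<open>The two averages differ only on overflowing residues, whose proportion decays
  geometrically while \<open>f\<close> grows polynomially along the walk.\<close>

lemma avg_walk_minus_settled_avg_tendsto:
  assumes "\<And>d. \<bar>f d\<bar> \<le> A * (1 + \<bar>real_of_int d\<bar> ^ 3)" "A \<ge> 0"
  shows "(\<lambda>k. avg k (\<lambda>n. f (walk k n)) - settled_avg k f) \<longlonglongrightarrow> 0"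
proof (rule Lim_null_comparison)
  show "\<forall>\<^sub>F k in sequentially. norm (avg k (\<lambda>n. f (walk k n)) - settled_avg k f)
      \<le> A * growth_bound (Suc k) * (real r / real b ^ k)"
  proof (rule always_eventually, rule allI)
    fix k
    have U: "\<bar>f (walk k n)\<bar> \<le> A * growth_bound (Suc k)" for n
    proof -
      have "\<bar>f (walk k n)\<bar> \<le> A * growth_bound k"
        using assms(1)[of "walk k n"] growth_bound_walk[of k n] assms(2)
        by (meson mult_left_mono order_trans)
      also have "\<dots> \<le> A * growth_bound (Suc k)"
        using assms(2) unfolding growth_bound_def by (intro mult_left_mono add_left_mono power_mono) auto
      finally show ?thesis .
    qed
    have "norm (avg k (\<lambda>n. f (walk k n)) - settled_avg k f)
        \<le> avg k (\<lambda>n. \<bar>f (walk k n) - of_bool (n + r < b ^ k) * f (Delta b r n)\<bar>)"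
      unfolding settled_avg_def avg_diff[symmetric] real_norm_def by (rule abs_avg_le)
    also have "\<dots> \<le> avg k (\<lambda>n. A * growth_bound (Suc k) * of_bool (\<not> n + r < b ^ k))"
      using U by (intro avg_mono) (auto simp: Delta_eq_walk)
    also have "\<dots> \<le> A * growth_bound (Suc k) * (real r / real b ^ k)"
      unfolding avg_cmult using assms(2)
      by (intro mult_left_mono avg_overflow_le) (auto simp: growth_bound_def)
    finally show "norm (avg k (\<lambda>n. f (walk k n)) - settled_avg k f)
        \<le> A * growth_bound (Suc k) * (real r / real b ^ k)" .
  qed
qed (rule overflow_tendsto)

text \<open>Splitting into positive and negative parts removes the sign condition. From here on,
  statements about \<open>mu\<close> follow from statements about the finite averages
  \<open>avg\<close>.\<close>

lemma has_sum_mu: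
  assumes f: "\<And>d. \<bar>f d\<bar> \<le> A * (1 + \<bar>real_of_int d\<bar> ^ 3)"
  obtains S where "((\<lambda>d. mu b r d * f d) has_sum S) UNIV" "(\<lambda>k. avg k (\<lambda>n. f (walk k n))) \<longlonglongrightarrow> S"
proof -
  have A: "A \<ge> 0" using f[of 0] by (simp add: abs_le_iff)
  let ?p = "\<lambda>d. max (f d) 0" and ?n = "\<lambda>d. max (- f d) 0"
  have p: "\<bar>?p d\<bar> \<le> A * (1 + \<bar>real_of_int d\<bar> ^ 3)" and n: "\<bar>?n d\<bar> \<le> A * (1 + \<bar>real_of_int d\<bar> ^ 3)" for d
    using f[of d] by (auto simp: abs_le_iff max_def)
  obtain S1 where S1: "(\<lambda>k. settled_avg k ?p) \<longlonglongrightarrow> S1" "\<And>k. settled_avg k ?p \<le> S1"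
    by (rule settled_avg_convergent[OF p A]) auto
  obtain S2 where S2: "(\<lambda>k. settled_avg k ?n) \<longlonglongrightarrow> S2" "\<And>k. settled_avg k ?n \<le> S2"
    by (rule settled_avg_convergent[OF n A]) auto
  have "((\<lambda>d. mu b r d * ?p d + - (mu b r d * ?n d)) has_sum (S1 + - S2)) UNIV"
    by (intro has_sum_add has_sum_uminusI has_sum_mu_nonneg S1 S2) auto
  moreover have "mu b r d * ?p d + - (mu b r d * ?n d) = mu b r d * f d" for d
    by (auto simp: max_def)
  ultimately have 1: "((\<lambda>d. mu b r d * f d) has_sum (S1 - S2)) UNIV" by simp
  have "settled_avg k f = settled_avg k ?p - settled_avg k ?n" for k
    unfolding settled_avg_def avg_diff[symmetric] by (intro avg_cong) (auto simp: max_def)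
  then have "(\<lambda>k. settled_avg k f) \<longlonglongrightarrow> S1 - S2" using tendsto_diff[OF S1(1) S2(1)] by simp
  from tendsto_add[OF avg_walk_minus_settled_avg_tendsto[OF f A] this]
  have "(\<lambda>k. avg k (\<lambda>n. f (walk k n))) \<longlonglongrightarrow> S1 - S2" by simp
  with 1 show ?thesis by (rule that)
qed

subsection \<open>Lindeberg replacement\<close>

definition total_var :: real where
  "total_var = suminf step_var"

lemma step_var_sums: "step_var sums total_var" and has_sum_mu_sq: "((\<lambda>d. mu b r d * (real_of_int d)\<^sup>2) has_sum total_var) UNIV"
proof -
  have "\<bar>(real_of_int d)\<^sup>2\<bar> \<le> 1 * (1 + \<bar>real_of_int d\<bar> ^ 3)" for d
    using le_one_plus_cubed(2)[of "\<bar>real_of_int d\<bar>"] by simp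
  then obtain S where S: "((\<lambda>d. mu b r d * (real_of_int d)\<^sup>2) has_sum S) UNIV"
    "(\<lambda>k. avg k (\<lambda>n. (real_of_int (walk k n))\<^sup>2)) \<longlonglongrightarrow> S"
    by (rule has_sum_mu)
  then have "step_var sums S" by (simp add: avg_walk_sq sums_def)
  moreover from this have "S = total_var" unfolding total_var_def by (rule sums_unique)
  ultimately show "step_var sums total_var" "((\<lambda>d. mu b r d * (real_of_int d)\<^sup>2) has_sum total_var) UNIV" using S by auto
qed

text \<open>The martingale has mean 0 at every stage, and so does its limit law.\<close>

lemma has_sum_mu_id: "((\<lambda>d. mu b r d * real_of_int d) has_sum 0) UNIV"
proof -
  have "\<bar>real_of_int d\<bar> \<le> 1 * (1 + \<bar>real_of_int d\<bar> ^ 3)" for d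
    using le_one_plus_cubed(1)[of "\<bar>real_of_int d\<bar>"] by simp
  then obtain S where S: "((\<lambda>d. mu b r d * real_of_int d) has_sum S) UNIV"
    "(\<lambda>k. avg k (\<lambda>n. real_of_int (walk k n))) \<longlonglongrightarrow> S"
    by (rule has_sum_mu)
  then show ?thesis by (simp add: avg_walk LIMSEQ_const_iff)
qed

lemma has_sum_mu_one: "(mu b r has_sum 1) UNIV"
proof -
  have "\<bar>1::real\<bar> \<le> 1 * (1 + \<bar>real_of_int d\<bar> ^ 3)" for d by simp
  then obtain S where S: "((\<lambda>d. mu b r d * 1) has_sum S) UNIV" "(\<lambda>k. avg k (\<lambda>n. 1)) \<longlonglongrightarrow> S"
    by (rule has_sum_mu)
  then show ?thesis by (simp add: LIMSEQ_const_iff)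
qed

lemma sigma_eq: "sigma b r = sqrt total_var"
  using infsumI[OF has_sum_mu_sq] infsumI[OF has_sum_mu_id]
  by (simp add: sigma_def mult.commute)

lemma sum_step_var_le: "finite I \<Longrightarrow> sum step_var I \<le> total_var"
  unfolding total_var_def using step_var_sums step_var_nonneg by (intro sum_le_suminf) (auto simp: sums_iff)

lemma step_var_le: "step_var k \<le> (real b)\<^sup>2"
proof -
  have "step_var k \<le> avg k (\<lambda>_. (real b)\<^sup>2)"
    unfolding step_var_def power2_eq_square using addend_le by (intro avg_mono mult_mono) auto
  then show ?thesis by simp
qed

section \<open>Decay of the correlation between walk and carry\<close>

text \<open>The recursion for the correlation: the factor \<open>1 / b\<close>, at most
  \<open>1 / 2\<close>, contracts the old bound, and the new step adds its variance.\<close>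

primrec corr_bound :: "nat \<Rightarrow> real" where
  "corr_bound 0 = 0"
| "corr_bound (Suc k) = corr_bound k / 2 + step_var k"

lemma corr_bound_nonneg: "0 \<le> corr_bound k"
  by (induction k) (auto simp: step_var_nonneg)

text \<open>Summation of a geometric convolution. The extra \<open>2 * corr_bound k\<close> makes
  the induction balance exactly.\<close>

lemma sum_corr_bound_le: "(\<Sum>j<k. corr_bound j) + 2 * corr_bound k \<le> 2 * (\<Sum>j<k. step_var j)"
  by (induction k) auto

text \<open>Given the lower digits, the centred new carry has mean \<open>1 / b\<close> times the
  centred old carry. Freezing \<open>g\<close> at the old walk thus yields the contraction, while
  the increment of \<open>g\<close> is bounded through the Lipschitz constant.\<close>

lemma carry_correlation:
  assumes lip: "\<And>x y. \<bar>g x - g y\<bar> \<le> L * \<bar>x - y\<bar>"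
  shows "\<bar>avg k (\<lambda>n. g (real_of_int (walk k n)) * (real (carry k n) - carry_mean k))\<bar> \<le> L * corr_bound k"
proof (induction k)
  case (Suc k)
  have L: "L \<ge> 0" using lip[of 0 1] by simp
  define c' where "c' = carry_mean (Suc k)"
  have c': "0 \<le> c'" "c' \<le> 1" unfolding c'_def by (rule carry_mean_bounds)+
  \<comment> \<open>The part of the correlation caused by the change of \<open>g\<close> along the
    step.\<close>
  let ?R = "\<lambda>m. ((real b - real (addend k m)) * ((g (real_of_int (walk k m + int (addend k m))) - g (real_of_int (walk k m))) * (- c'))
       + real (addend k m) * ((g (real_of_int (walk k m + int (addend k m) - int b)) - g (real_of_int (walk k m))) * (1 - c'))) / real b"
  have "avg (Suc k) (\<lambda>n. g (real_of_int (walk (Suc k) n)) * (real (carry (Suc k) n) - c'))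
      = avg k (\<lambda>m. (1 / real b) * (g (real_of_int (walk k m)) * (real (carry k m) - carry_mean k)) + ?R m)"
    unfolding avg_step[where \<phi> = "\<lambda>d c. g (real_of_int d) * (real c - c')"]
  proof (rule avg_cong)
    fix m
    have "b * c' = real (digit k) + carry_mean k" by (simp add: c'_def carry_mean_Suc)
    then have e: "real (carry k m) - carry_mean k = real (addend k m) - real b * c'" by (simp add: addend_def)
    show "((real b - real (addend k m)) * (g (real_of_int (walk k m + int (addend k m))) * (real 0 - c'))
         + real (addend k m) * (g (real_of_int (walk k m + int (addend k m) - int b)) * (real 1 - c'))) / real b
       = (1 / real b) * (g (real_of_int (walk k m)) * (real (carry k m) - carry_mean k)) + ?R m"
      unfolding e by (simp add: divide_simps) (simp add: algebra_simps)
  qed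
  also have "\<dots> = (1 / real b) * avg k (\<lambda>m. g (real_of_int (walk k m)) * (real (carry k m) - carry_mean k)) + avg k ?R"
    unfolding avg_add avg_cmult ..
  finally have eq: "avg (Suc k) (\<lambda>n. g (real_of_int (walk (Suc k) n)) * (real (carry (Suc k) n) - c'))
    = (1 / real b) * avg k (\<lambda>m. g (real_of_int (walk k m)) * (real (carry k m) - carry_mean k)) + avg k ?R" .
  have "\<bar>?R m\<bar> \<le> L * (real (addend k m) * (real b - real (addend k m)))" for m
  proof -
    define q where "q = real (addend k m)"
    define x where "x = real_of_int (walk k m)"
    have q: "0 \<le> q" "q \<le> real b" using addend_le[of k m] by (auto simp: q_def)
    have 1: "\<bar>g (x + q) - g x\<bar> \<le> L * q" "\<bar>g (x + q - real b) - g x\<bar> \<le> L * (real b - q)"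
      using lip[of "x + q" x] lip[of "x + q - real b" x] q by auto
    have "\<bar>?R m\<bar> = \<bar>(real b - q) * ((g (x + q) - g x) * (- c')) + q * ((g (x + q - real b) - g x) * (1 - c'))\<bar> / real b"
      by (simp add: q_def x_def)
    also have "\<dots> \<le> ((real b - q) * ((L * q) * c') + q * ((L * (real b - q)) * (1 - c'))) / real b"
    proof (rule divide_right_mono)
      have "\<bar>(real b - q) * ((g (x + q) - g x) * (- c'))\<bar> \<le> (real b - q) * ((L * q) * c')"
        unfolding abs_mult using q c' 1 by (intro mult_mono) auto
      moreover have "\<bar>q * ((g (x + q - real b) - g x) * (1 - c'))\<bar> \<le> q * ((L * (real b - q)) * (1 - c'))"
        unfolding abs_mult using q c' 1 by (intro mult_mono) auto
      ultimately show "\<bar>(real b - q) * ((g (x + q) - g x) * (- c')) + q * ((g (x + q - real b) - g x) * (1 - c'))\<bar>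
          \<le> (real b - q) * ((L * q) * c') + q * ((L * (real b - q)) * (1 - c'))" by linarith
    qed simp
    \<comment> \<open>Both terms contain \<open>q * (b - q)\<close>, and their weights
      \<open>c'\<close> and \<open>1 - c'\<close> add up to 1.\<close>
    also have "\<dots> = L * (q * (real b - q)) / real b"
      by (simp add: algebra_simps)
    also have "\<dots> \<le> L * (q * (real b - q))"
      using b L q mult_left_mono[of 1 "real b" "L * (q * (real b - q))"]
      by (simp add: divide_le_eq)
    finally show ?thesis by (simp add: q_def)
  qed
  then have "avg k (\<lambda>m. \<bar>?R m\<bar>) \<le> avg k (\<lambda>m. L * (real (addend k m) * (real b - real (addend k m))))"
    by (rule avg_mono)
  then have R: "\<bar>avg k ?R\<bar> \<le> L * step_var k"
    unfolding avg_cmult step_var_def[symmetric] by (rule order_trans[OF abs_avg_le])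
  have "\<bar>(1 / real b) * avg k (\<lambda>m. g (real_of_int (walk k m)) * (real (carry k m) - carry_mean k))\<bar> \<le> (1 / 2) * (L * corr_bound k)"
    unfolding abs_mult using b by (intro mult_mono Suc.IH) (auto simp: field_simps)
  with R have "\<bar>avg (Suc k) (\<lambda>n. g (real_of_int (walk (Suc k) n)) * (real (carry (Suc k) n) - c'))\<bar>
      \<le> (1 / 2) * (L * corr_bound k) + L * step_var k"
    unfolding eq by linarith
  then show ?case by (simp add: c'_def algebra_simps)
qed simp

section \<open>Replacing digit steps by Gaussian steps\<close>

text \<open>The two-point law of the step is centred with variance \<open>q * (b - q)\<close>, so
  only the Taylor remainders are left. Their weights form the third absolute moment, at most
  \<open>b\<close> times the variance.\<close>

lemma digit_step_taylor:
  assumes "taylor3 M f f1 f2" "0 \<le> q" "q \<le> real b"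
  shows "\<bar>((real b - q) * f (x + q) + q * f (x + q - real b)) / real b - f x - q * (real b - q) / 2 * f2 x\<bar>
     \<le> M * real b * (q * (real b - q))"
proof -
  note M = taylor3_nonneg[OF assms(1)]
  define T where "T = (\<lambda>t. f (x + t) - f x - f1 x * t - f2 x * t\<^sup>2 / 2)"
  have T: "\<bar>T t\<bar> \<le> M * \<bar>t\<bar> ^ 3" for t
    using assms(1) unfolding taylor3_def T_def by blast
  have "((real b - q) * f (x + q) + q * f (x + q - real b)) / real b - f x - q * (real b - q) / 2 * f2 x
      = ((real b - q) * T q + q * T (q - real b)) / real b"
    unfolding T_def by (simp add: divide_simps) (simp add: algebra_simps power2_eq_square)
  also have "\<bar>\<dots>\<bar> \<le> ((real b - q) * (M * q ^ 3) + q * (M * (real b - q) ^ 3)) / real b"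
  proof -
    have "\<bar>(real b - q) * T q\<bar> \<le> (real b - q) * (M * q ^ 3)"
      unfolding abs_mult using assms T[of q] by (intro mult_mono) auto
    moreover have "\<bar>q * T (q - real b)\<bar> \<le> q * (M * (real b - q) ^ 3)"
      unfolding abs_mult using assms T[of "q - real b"] by (intro mult_mono) auto
    ultimately have "\<bar>(real b - q) * T q + q * T (q - real b)\<bar> \<le> (real b - q) * (M * q ^ 3) + q * (M * (real b - q) ^ 3)"
      by linarith
    then show ?thesis by (simp add: divide_right_mono)
  qed
  also have "\<dots> = M * (q * (real b - q)) * (q\<^sup>2 + (real b - q)\<^sup>2) / real b"
    by (simp add: power2_eq_square power3_eq_cube algebra_simps)
  also have "\<dots> \<le> M * (q * (real b - q)) * (real b)\<^sup>2 / real b"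
  proof (intro divide_right_mono mult_left_mono)
    have "(real b)\<^sup>2 - (q\<^sup>2 + (real b - q)\<^sup>2) = 2 * (q * (real b - q))"
      by (simp add: power2_eq_square algebra_simps)
    moreover have "0 \<le> q * (real b - q)" using assms by simp
    ultimately show "q\<^sup>2 + (real b - q)\<^sup>2 \<le> (real b)\<^sup>2" by linarith
  qed (use M assms in auto)
  also have "\<dots> = M * real b * (q * (real b - q))" by (simp add: power2_eq_square)
  finally show ?thesis .
qed

text \<open>One exchange, with \<open>f\<close> already smoothed by the variance \<open>v\<close> of
  the later steps. Three errors are compared: digit step against its conditional variance, Gaussian
  step against the mean variance, and conditional against mean variance.\<close>

lemma lindeberg_step:
  assumes g: "taylor3 M g g1 g2" and v: "v \<ge> 0"
  shows "\<bar>avg (Suc k) (\<lambda>n. gauss v g (real_of_int (walk (Suc k) n))) - avg k (\<lambda>n. gauss (step_var k + v) g (real_of_int (walk k n)))\<bar>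
     \<le> 3 * M * real b * (step_var k + corr_bound k)"
proof -
  define f f1 f2 where "f = gauss v g" and "f1 = gauss v g1" and "f2 = gauss v g2"
  have f: "taylor3 M f f1 f2" unfolding f_def f1_def f2_def by (rule taylor3_gauss[OF g])
  note M = taylor3_nonneg[OF g]
  let ?x = "\<lambda>n. real_of_int (walk k n)" and ?q = "\<lambda>n. real (addend k n)"
  let ?v = "\<lambda>n. ?q n * (real b - ?q n)"
  let ?s = "\<lambda>n. ((real b - ?q n) * f (?x n + ?q n) + ?q n * f (?x n + ?q n - real b)) / real b"
  have A: "\<bar>avg k (\<lambda>n. ?s n - f (?x n) - ?v n / 2 * f2 (?x n))\<bar> \<le> M * real b * step_var k"
  proof -
    have "avg k (\<lambda>n. \<bar>?s n - f (?x n) - ?v n / 2 * f2 (?x n)\<bar>) \<le> avg k (\<lambda>n. M * real b * ?v n)"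
      using addend_le by (intro avg_mono digit_step_taylor[OF f]) auto
    then show ?thesis unfolding avg_cmult step_var_def[symmetric] by (rule order_trans[OF abs_avg_le])
  qed
  have B: "\<bar>avg k (\<lambda>n. gauss (step_var k) f (?x n) - f (?x n) - step_var k * f2 (?x n) / 2)\<bar> \<le> 2 * M * real b * step_var k"
  proof -
    have "\<bar>gauss (step_var k) f x - f x - step_var k * f2 x / 2\<bar> \<le> 2 * M * real b * step_var k" for x
    proof -
      have "\<bar>gauss (step_var k) f x - f x - step_var k * f2 x / 2\<bar> \<le> 2 * M * step_var k * sqrt (step_var k)"
        by (rule gauss_taylor_bound[OF f step_var_nonneg])
      \<comment> \<open>The standard deviation of a step is at most \<open>b\<close>, which turns
        the power 3/2 of the variance into a multiple of the variance.\<close>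
      also have "\<dots> \<le> 2 * M * step_var k * real b"
        using M step_var_nonneg step_var_le by (intro mult_left_mono real_le_lsqrt) auto
      finally show ?thesis by (simp add: ac_simps)
    qed
    then have "avg k (\<lambda>n. \<bar>gauss (step_var k) f (?x n) - f (?x n) - step_var k * f2 (?x n) / 2\<bar>) \<le> avg k (\<lambda>n. 2 * M * real b * step_var k)"
      by (rule avg_mono)
    then show ?thesis unfolding avg_const by (rule order_trans[OF abs_avg_le])
  qed
  \<comment> \<open>Here the random variance is compared with its mean: the difference is
    \<open>a\<close> times the centred carry, so its correlation with the Lipschitz function
    \<open>f2\<close> decides.\<close>
  have C: "\<bar>avg k (\<lambda>n. ?v n / 2 * f2 (?x n) - step_var k * f2 (?x n) / 2)\<bar> \<le> 3 * M * real b * corr_bound k"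
  proof -
    define a where "a = real b - 1 - 2 * real (digit k)"
    have a: "\<bar>a\<bar> \<le> real b" using digit_less[of k] unfolding a_def by (auto simp: abs_le_iff)
    have "avg k (\<lambda>n. ?v n / 2 * f2 (?x n) - step_var k * f2 (?x n) / 2)
        = avg k (\<lambda>n. (a / 2) * (f2 (?x n) * (real (carry k n) - carry_mean k)))"
      by (intro avg_cong, unfold addend_var_affine step_var_eq a_def[symmetric]) (simp add: field_simps)
    also have "\<dots> = a / 2 * avg k (\<lambda>n. f2 (?x n) * (real (carry k n) - carry_mean k))" by (rule avg_cmult)
    finally have "\<bar>avg k (\<lambda>n. ?v n / 2 * f2 (?x n) - step_var k * f2 (?x n) / 2)\<bar>
        = \<bar>a\<bar> / 2 * \<bar>avg k (\<lambda>n. f2 (?x n) * (real (carry k n) - carry_mean k))\<bar>"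
      by (simp only: abs_mult abs_divide abs_numeral)
    also have "\<dots> \<le> real b / 2 * (6 * M * corr_bound k)"
      using a f by (intro mult_mono carry_correlation) (auto simp: taylor3_def)
    finally show ?thesis by simp
  qed
  have 1: "avg (Suc k) (\<lambda>n. gauss v g (real_of_int (walk (Suc k) n))) = avg k ?s"
    using avg_step[where \<phi> = "\<lambda>d _. f (real_of_int d)" and k = k] by (simp add: f_def)
  have 2: "gauss (step_var k + v) g x = gauss (step_var k) f x" for x
    unfolding f_def by (rule gauss_gauss[symmetric, OF taylor3_cubic_growth(1)[OF g] step_var_nonneg v])
  have "avg k ?s - avg k (\<lambda>n. gauss (step_var k) f (?x n))
    = avg k (\<lambda>n. ?s n - f (?x n) - ?v n / 2 * f2 (?x n))
      - avg k (\<lambda>n. gauss (step_var k) f (?x n) - f (?x n) - step_var k * f2 (?x n) / 2)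
      + avg k (\<lambda>n. ?v n / 2 * f2 (?x n) - step_var k * f2 (?x n) / 2)"
    unfolding avg_add[symmetric] avg_diff[symmetric] by (rule avg_cong) simp
  then have "\<bar>avg k ?s - avg k (\<lambda>n. gauss (step_var k) f (?x n))\<bar>
      \<le> M * real b * step_var k + 2 * M * real b * step_var k + 3 * M * real b * corr_bound k"
    using A B C by linarith
  then show ?thesis unfolding 1 2 by (simp add: algebra_simps)
qed

text \<open>Telescoping over digits: at \<open>k = 0\<close> the walk is 0 and the whole variance is
  Gaussian; after \<open>k\<close> digits only the variance of the remaining ones is.\<close>

lemma lindeberg_finite:
  assumes g: "taylor3 M g g1 g2"
  shows "\<bar>avg k (\<lambda>n. gauss (total_var - sum step_var {..<k}) g (real_of_int (walk k n))) - gauss total_var g 0\<bar>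
    \<le> 3 * M * real b * (\<Sum>j<k. step_var j + corr_bound j)"
proof (induction k)
  case (Suc k)
  have "step_var k + (total_var - sum step_var {..<Suc k}) = total_var - sum step_var {..<k}" by simp
  then show ?case
    using Suc lindeberg_step[OF g, of "total_var - sum step_var {..<Suc k}" k] sum_step_var_le[of "{..<Suc k}"]
    by (simp add: distrib_left)
qed simp

text \<open>Passage to infinitely many digits: the remaining Gaussian variance
  \<open>\<omega> k\<close> tends to 0, so the hybrid averages converge to the expectation under
  \<open>mu\<close>.\<close>

lemma lindeberg:
  assumes g: "taylor3 M g g1 g2"
  obtains S where "((\<lambda>d. mu b r d * g (real_of_int d)) has_sum S) UNIV"
    "\<bar>S - gauss total_var g 0\<bar> \<le> 9 * M * real b * total_var"
proof -
  note M = taylor3_nonneg[OF g]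
  obtain A where A: "\<And>x. \<bar>g x\<bar> \<le> A * (1 + \<bar>x\<bar> ^ 3)"
    using taylor3_cubic_growth(1)[OF g] unfolding cubic_growth_def by blast
  obtain S where S: "((\<lambda>d. mu b r d * g (real_of_int d)) has_sum S) UNIV"
    "(\<lambda>k. avg k (\<lambda>n. g (real_of_int (walk k n)))) \<longlonglongrightarrow> S"
    using has_sum_mu[of "\<lambda>d. g (real_of_int d)" A] A by blast
  define \<omega> where "\<omega> = (\<lambda>k. total_var - sum step_var {..<k})"
  have \<omega>0: "\<omega> k \<ge> 0" for k using sum_step_var_le[of "{..<k}"] by (simp add: \<omega>_def)
  have \<omega>: "\<omega> \<longlonglongrightarrow> 0"
    using tendsto_diff[OF tendsto_const[of total_var] step_var_sums[unfolded sums_def]] by (simp add: \<omega>_def)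
  \<comment> \<open>Dominates the average of \<open>\<bar>g2\<bar>\<close> along the walk uniformly
    in \<open>k\<close>, by the Lipschitz condition, \<open>\<bar>x\<bar> \<le> 1 + x^2\<close> and
    the second moment of the walk.\<close>
  define K where "K = \<bar>g2 0\<bar> + 6 * M * (1 + total_var)"
  have "(\<lambda>k. avg k (\<lambda>n. gauss (\<omega> k) g (real_of_int (walk k n))) - avg k (\<lambda>n. g (real_of_int (walk k n)))) \<longlonglongrightarrow> 0"
  proof (rule Lim_null_comparison)
    show "\<forall>\<^sub>F k in sequentially. norm (avg k (\<lambda>n. gauss (\<omega> k) g (real_of_int (walk k n))) - avg k (\<lambda>n. g (real_of_int (walk k n))))
      \<le> \<omega> k / 2 * K + 2 * M * \<omega> k * sqrt (\<omega> k)"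
    proof (rule always_eventually, rule allI)
      fix k
      let ?x = "\<lambda>n. real_of_int (walk k n)"
      have "norm (avg k (\<lambda>n. gauss (\<omega> k) g (?x n)) - avg k (\<lambda>n. g (?x n)))
          \<le> avg k (\<lambda>n. \<bar>gauss (\<omega> k) g (?x n) - g (?x n)\<bar>)"
        unfolding avg_diff[symmetric] real_norm_def by (rule abs_avg_le)
      also have "\<dots> \<le> avg k (\<lambda>n. \<omega> k / 2 * (\<bar>g2 0\<bar> + 6 * M * (1 + (?x n)\<^sup>2)) + 2 * M * \<omega> k * sqrt (\<omega> k))"
      proof (rule avg_mono)
        fix n
        have "\<bar>gauss (\<omega> k) g (?x n) - g (?x n) - \<omega> k * g2 (?x n) / 2\<bar> \<le> 2 * M * \<omega> k * sqrt (\<omega> k)"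
          by (rule gauss_taylor_bound[OF g \<omega>0])
        moreover have "\<bar>\<omega> k * g2 (?x n) / 2\<bar> \<le> \<omega> k / 2 * (\<bar>g2 0\<bar> + 6 * M * (1 + (?x n)\<^sup>2))"
        proof -
          have "\<bar>g2 (?x n) - g2 0\<bar> \<le> 6 * M * \<bar>?x n - 0\<bar>" using g unfolding taylor3_def by blast
          then have "\<bar>g2 (?x n)\<bar> \<le> \<bar>g2 0\<bar> + 6 * M * \<bar>?x n\<bar>" by simp
          also have "\<dots> \<le> \<bar>g2 0\<bar> + 6 * M * (1 + (?x n)\<^sup>2)"
          proof (intro add_left_mono mult_left_mono)
            have "0 \<le> (\<bar>?x n\<bar> - 1)\<^sup>2" by simp
            then have "2 * \<bar>?x n\<bar> \<le> 1 + (?x n)\<^sup>2" by (simp add: power2_diff)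
            then show "\<bar>?x n\<bar> \<le> 1 + (?x n)\<^sup>2" by linarith
          qed (use M in auto)
          finally have "\<omega> k / 2 * \<bar>g2 (?x n)\<bar> \<le> \<omega> k / 2 * (\<bar>g2 0\<bar> + 6 * M * (1 + (?x n)\<^sup>2))"
            using \<omega>0[of k] by (intro mult_left_mono) auto
          then show ?thesis using \<omega>0[of k] by (simp add: abs_mult)
        qed
        ultimately show "\<bar>gauss (\<omega> k) g (?x n) - g (?x n)\<bar>
            \<le> \<omega> k / 2 * (\<bar>g2 0\<bar> + 6 * M * (1 + (?x n)\<^sup>2)) + 2 * M * \<omega> k * sqrt (\<omega> k)" by linarith
      qed
      also have "\<dots> = \<omega> k / 2 * (\<bar>g2 0\<bar> + 6 * M * (1 + sum step_var {..<k})) + 2 * M * \<omega> k * sqrt (\<omega> k)"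
        unfolding avg_add avg_cmult avg_const avg_walk_sq ..
      also have "\<dots> \<le> \<omega> k / 2 * K + 2 * M * \<omega> k * sqrt (\<omega> k)"
        unfolding K_def using \<omega>0[of k] M sum_step_var_le[of "{..<k}"]
        by (intro add_right_mono mult_left_mono add_left_mono) auto
      finally show "norm (avg k (\<lambda>n. gauss (\<omega> k) g (?x n)) - avg k (\<lambda>n. g (?x n)))
          \<le> \<omega> k / 2 * K + 2 * M * \<omega> k * sqrt (\<omega> k)" .
    qed
    have "(\<lambda>k. \<omega> k / 2 * K + 2 * M * \<omega> k * sqrt (\<omega> k)) \<longlonglongrightarrow> 0 / 2 * K + 2 * M * 0 * sqrt 0"
      by (intro tendsto_intros \<omega>) auto
    then show "(\<lambda>k. \<omega> k / 2 * K + 2 * M * \<omega> k * sqrt (\<omega> k)) \<longlonglongrightarrow> 0" by simp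
  qed
  from tendsto_add[OF this S(2)]
  have "(\<lambda>k. avg k (\<lambda>n. gauss (\<omega> k) g (real_of_int (walk k n)))) \<longlonglongrightarrow> S" by simp
  then have lim: "(\<lambda>k. \<bar>avg k (\<lambda>n. gauss (\<omega> k) g (real_of_int (walk k n))) - gauss total_var g 0\<bar>) \<longlonglongrightarrow> \<bar>S - gauss total_var g 0\<bar>"
    by (intro tendsto_intros)
  have "\<bar>S - gauss total_var g 0\<bar> \<le> 9 * M * real b * total_var"
  proof (rule LIMSEQ_le_const2[OF lim], intro exI allI impI)
    fix k
    have "\<bar>avg k (\<lambda>n. gauss (\<omega> k) g (real_of_int (walk k n))) - gauss total_var g 0\<bar> \<le> 3 * M * real b * (\<Sum>j<k. step_var j + corr_bound j)"
      unfolding \<omega>_def by (rule lindeberg_finite[OF g])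
    \<comment> \<open>The step variances sum to at most \<open>total_var\<close>, the correlation
      bounds to at most twice that.\<close>
    also have "\<dots> \<le> 3 * M * real b * (3 * total_var)"
      using M sum_corr_bound_le[of k] corr_bound_nonneg[of k] sum_step_var_le[of "{..<k}"]
      by (intro mult_left_mono) (auto simp: sum.distrib)
    finally show "\<bar>avg k (\<lambda>n. gauss (\<omega> k) g (real_of_int (walk k n))) - gauss total_var g 0\<bar> \<le> 9 * M * real b * total_var" by simp
  qed
  with S(1) show ?thesis by (rule that)
qed

end

subsection \<open>Blocks and variance\<close>

lemma nth_digits: "i < length (digits b n) \<Longrightarrow> digits b n ! i = n div b ^ i mod b"
proof (induction b n arbitrary: i rule: digits.induct)
  case (1 b n)
  show ?case
  proof (cases "b < 2 \<or> n = 0")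
    case True
    then show ?thesis using 1(2) by (simp add: digits.simps)
  next
    case False
    then have eq: "digits b n = n mod b # digits b (n div b)" by (simp add: digits.simps)
    show ?thesis
    proof (cases i)
      case (Suc j)
      then have "digits b (n div b) ! j = n div b div b ^ j mod b"
        using 1 False eq by auto
      then show ?thesis using Suc eq by (simp add: div_mult2_eq)
    qed (simp add: eq)
  qed
qed

text \<open>Locates the top digit: the position just below the length carries a nonzero digit, all
  higher ones are 0.\<close>

lemma length_digits_bounds:
  assumes "b \<ge> 2"
  shows "n < b ^ length (digits b n)" and "n > 0 \<Longrightarrow> b ^ (length (digits b n) - 1) \<le> n"
    and "n > 0 \<Longrightarrow> length (digits b n) > 0"
proof -
  have *: "n < b ^ length (digits b n) \<and> (n > 0 \<longrightarrow> length (digits b n) > 0 \<and> b ^ (length (digits b n) - 1) \<le> n)"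
    using assms
  proof (induction b n rule: digits.induct)
    case (1 b n)
    show ?case
    proof (cases "n = 0")
      case False
      then have eq: "digits b n = n mod b # digits b (n div b)" using 1 by (simp add: digits.simps)
      have IH: "n div b < b ^ length (digits b (n div b))"
        "n div b > 0 \<Longrightarrow> length (digits b (n div b)) > 0 \<and> b ^ (length (digits b (n div b)) - 1) \<le> n div b"
        using 1 False by auto
      have "n < b * b ^ length (digits b (n div b))"
        using IH(1) 1(2) by (simp add: div_less_iff_less_mult mult.commute)
      moreover have "b ^ length (digits b (n div b)) \<le> n"
      proof (cases "n div b = 0")
        case True
        then show ?thesis using False by (simp add: digits.simps)
      next
        case nz: False
        then obtain l where l: "length (digits b (n div b)) = Suc l" "b ^ l \<le> n div b"
          using IH(2) by (cases "length (digits b (n div b))") auto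
        then have "b * b ^ l \<le> b * (n div b)" by (intro mult_left_mono) auto
        also have "\<dots> \<le> n" by simp
        finally show ?thesis using l by simp
      qed
      ultimately show ?thesis by (simp add: eq)
    qed (simp add: digits.simps)
  qed
  show "n < b ^ length (digits b n)" "n > 0 \<Longrightarrow> b ^ (length (digits b n) - 1) \<le> n"
    "n > 0 \<Longrightarrow> length (digits b n) > 0" using * by auto
qed

context base_addition
begin

text \<open>\<open>step_var\<close> interpolates between \<open>p * (b - p)\<close> and
  \<open>(p + 1) * (b - p - 1)\<close> with weight \<open>c\<close>. Both are at least 1 for an
  inner digit. At \<open>p = 0\<close> or \<open>p = b - 1\<close> one of them vanishes, but the
  differing digit below keeps the weight of the other at least \<open>1 / b\<close>.\<close>

lemma step_var_block_start:
  assumes "digit (Suc j) \<noteq> digit j \<or> digit (Suc j) \<notin> {0, b - 1}"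
  shows "step_var (Suc j) \<ge> 1 / 2"
proof -
  define p c where "p = real (digit (Suc j))" and "c = carry_mean (Suc j)"
  have c: "0 \<le> c" "c \<le> 1" unfolding c_def by (rule carry_mean_bounds)+
  have bc: "real b * c = real (digit j) + carry_mean j" by (simp add: c_def carry_mean_Suc)
  have step_var: "step_var (Suc j) = p * (real b - p) * (1 - c) + (p + 1) * (real b - p - 1) * c"
    unfolding step_var_eq p_def c_def by (simp add: algebra_simps)
  have b2: "real b \<ge> 2" using b by simp
  \<comment> \<open>A weight of at least \<open>1 / b\<close> times the value \<open>b - 1\<close>,
    where \<open>(b - 1) / b\<close> is at least \<open>1 / 2\<close>.\<close>
  have half: "(real b - 1) * y \<ge> 1 / 2" if "real b * y \<ge> 1" for y
  proof -
    have "0 < real b * y" using that by linarith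
    then have "y \<ge> 0" by (simp add: zero_less_mult_iff)
    then have "real b / 2 * y \<le> (real b - 1) * y" using b2 by (intro mult_right_mono) auto
    with that show ?thesis by simp
  qed
  consider "digit (Suc j) = 0" | "digit (Suc j) = b - 1" | "digit (Suc j) \<notin> {0, b - 1}" by auto
  then show ?thesis
  proof cases
    case 1
    then have "digit j \<ge> 1" using assms by auto
    then have "real b * c \<ge> 1" using bc carry_mean_bounds(1)[of j] by simp
    then show ?thesis using half[of c] 1 step_var by (simp add: p_def)
  next
    case 2
    then have "digit j \<noteq> b - 1" using assms by auto
    then have "digit j + 2 \<le> b" using digit_less[of j] by linarith
    then have "real (digit j) + 2 \<le> real b" by (metis of_nat_add of_nat_le_iff of_nat_numeral)
    then have "real b * (1 - c) \<ge> 1" using bc carry_mean_bounds(2)[of j] by (simp add: algebra_simps)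
    moreover have "p = real b - 1" using 2 b by (simp add: p_def of_nat_diff)
    ultimately show ?thesis using half[of "1 - c"] step_var by simp
  next
    case 3
    then have "digit (Suc j) \<ge> 1" "digit (Suc j) + 2 \<le> b" using digit_less[of "Suc j"] by auto
    then have p: "p \<ge> 1" "p + 2 \<le> real b" unfolding p_def by linarith+
    have "1 * 1 \<le> p * (real b - p)" "1 * 1 \<le> (p + 1) * (real b - p - 1)"
      using p by (intro mult_mono; simp)+
    then have "1 * (1 - c) + 1 * c \<le> step_var (Suc j)"
      unfolding step_var using c by (intro add_mono mult_right_mono) auto
    then show ?thesis by simp
  qed
qed

text \<open>The link between blocks and variance: as many distinct positions as there are blocks
  contribute at least \<open>1 / 2\<close> each. In particular the variance is positive.\<close>

lemma rho_le_total_var: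
  assumes "r \<ge> 1"
  shows "real (rho b r) / 2 \<le> total_var" and "rho b r \<ge> 1"
proof -
  define l where "l = length (digits b r)"
  define S where "S = {i. i < l \<and> (i = 0 \<or> digits b r ! i \<noteq> digits b r ! (i - 1) \<or> digits b r ! i \<notin> {0, b - 1})}"
  have l: "l > 0" "r < b ^ l" "b ^ (l - 1) \<le> r"
    using length_digits_bounds[OF b] assms by (auto simp: l_def)
  have digit: "digits b r ! i = digit i" if "i < l" for i
    using nth_digits[of i b r] that by (simp add: l_def digit_def)
  have rho: "rho b r = card S" by (simp add: rho_def S_def l_def Let_def)
  have S: "finite S" "0 \<in> S" using l by (auto simp: S_def)
  show "rho b r \<ge> 1" unfolding rho using S by (metis One_nat_def Suc_leI card_gt_0_iff empty_iff)
  \<comment> \<open>The lowest block need not contribute (\<open>r\<^sub>0 = 0\<close>); the leading zero above the top digit replaces it.\<close>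
  define I where "I = insert l (S - {0})"
  have "l \<notin> S - {0}" by (simp add: S_def)
  then have cI: "card I = card S" using S card_Suc_Diff1[of S 0] by (simp add: I_def)
  have "1 / 2 \<le> step_var i" if i: "i \<in> I" for i
  proof -
    obtain j where j: "i = Suc j" using i l by (cases i) (auto simp: I_def)
    have "digit (Suc j) \<noteq> digit j \<or> digit (Suc j) \<notin> {0, b - 1}"
    proof (cases "i = l")
      case True
      have "digit l = 0" using l by (simp add: digit_def)
      moreover have "digit (l - 1) \<noteq> 0"
      proof -
        have "r div b ^ (l - 1) \<ge> 1" using l(3) by (simp add: Suc_le_eq div_greater_zero_iff)
        moreover have "r div b ^ (l - 1) < b"
          using l by (subst div_less_iff_less_mult) (auto simp flip: power_Suc)
        ultimately show ?thesis by (simp add: digit_def)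
      qed
      ultimately show ?thesis using True j by auto
    next
      case False
      then have "i \<in> S" "i < l" using i by (auto simp: I_def S_def)
      then show ?thesis using j digit[of i] digit[of j] by (auto simp: S_def)
    qed
    then show ?thesis using step_var_block_start j by simp
  qed
  then have "(\<Sum>i\<in>I. 1 / 2) \<le> sum step_var I" by (rule sum_mono)
  also have "\<dots> \<le> total_var" using S by (intro sum_step_var_le) (auto simp: I_def)
  finally show "real (rho b r) / 2 \<le> total_var" using cI by (simp add: rho)
qed

end

subsection \<open>Smoothing\<close>

lemma taylor3_const: "taylor3 0 (\<lambda>_. c) (\<lambda>_. 0) (\<lambda>_. 0)"
  by (simp add: taylor3_def)

lemma taylor3_add:
  assumes "taylor3 M g g1 g2" "taylor3 N h h1 h2"
  shows "taylor3 (M + N) (\<lambda>x. g x + h x) (\<lambda>x. g1 x + h1 x) (\<lambda>x. g2 x + h2 x)"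
  unfolding taylor3_def
proof (intro conjI allI)
  show "(\<lambda>x. g1 x + h1 x) \<in> borel_measurable borel"
    using assms unfolding taylor3_def by auto
  fix x t
  have "\<bar>g (x + t) - g x - g1 x * t - g2 x * t\<^sup>2 / 2\<bar> \<le> M * \<bar>t\<bar> ^ 3"
    "\<bar>h (x + t) - h x - h1 x * t - h2 x * t\<^sup>2 / 2\<bar> \<le> N * \<bar>t\<bar> ^ 3"
    using assms unfolding taylor3_def by blast+
  then show "\<bar>g (x + t) + h (x + t) - (g x + h x) - (g1 x + h1 x) * t - (g2 x + h2 x) * t\<^sup>2 / 2\<bar> \<le> (M + N) * \<bar>t\<bar> ^ 3"
    unfolding distrib_right add_divide_distrib by linarith
next
  fix x y
  have "\<bar>g2 x - g2 y\<bar> \<le> 6 * M * \<bar>x - y\<bar>" "\<bar>h2 x - h2 y\<bar> \<le> 6 * N * \<bar>x - y\<bar>"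
    using assms unfolding taylor3_def by blast+
  then show "\<bar>g2 x + h2 x - (g2 y + h2 y)\<bar> \<le> 6 * (M + N) * \<bar>x - y\<bar>"
    unfolding distrib_right distrib_left by linarith
qed

lemma taylor3_cmult:
  assumes "taylor3 M g g1 g2"
  shows "taylor3 (\<bar>c\<bar> * M) (\<lambda>x. c * g x) (\<lambda>x. c * g1 x) (\<lambda>x. c * g2 x)"
  unfolding taylor3_def
proof (intro conjI allI)
  show "(\<lambda>x. c * g1 x) \<in> borel_measurable borel"
    using assms unfolding taylor3_def by auto
  fix x t
  have "\<bar>g (x + t) - g x - g1 x * t - g2 x * t\<^sup>2 / 2\<bar> \<le> M * \<bar>t\<bar> ^ 3"
    using assms unfolding taylor3_def by blast
  then have "\<bar>c\<bar> * \<bar>g (x + t) - g x - g1 x * t - g2 x * t\<^sup>2 / 2\<bar> \<le> \<bar>c\<bar> * (M * \<bar>t\<bar> ^ 3)"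
    by (rule mult_left_mono) simp
  also have "\<bar>c\<bar> * \<bar>g (x + t) - g x - g1 x * t - g2 x * t\<^sup>2 / 2\<bar>
      = \<bar>c * g (x + t) - c * g x - c * g1 x * t - c * g2 x * t\<^sup>2 / 2\<bar>"
    unfolding abs_mult[symmetric] by (simp add: algebra_simps)
  finally show "\<bar>c * g (x + t) - c * g x - c * g1 x * t - c * g2 x * t\<^sup>2 / 2\<bar> \<le> \<bar>c\<bar> * M * \<bar>t\<bar> ^ 3"
    by (simp add: mult.assoc)
next
  fix x y
  have "\<bar>g2 x - g2 y\<bar> \<le> 6 * M * \<bar>x - y\<bar>"
    using assms unfolding taylor3_def by blast
  then have "\<bar>c\<bar> * \<bar>g2 x - g2 y\<bar> \<le> \<bar>c\<bar> * (6 * M * \<bar>x - y\<bar>)"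
    by (rule mult_left_mono) simp
  then show "\<bar>c * g2 x - c * g2 y\<bar> \<le> 6 * (\<bar>c\<bar> * M) * \<bar>x - y\<bar>"
    by (simp add: abs_mult[symmetric] algebra_simps)
qed

text \<open>Scaling costs the cube of the scale. It is applied both to normalise by the standard
  deviation and to sharpen the smoothed step to width \<open>\<delta>\<close>.\<close>

lemma taylor3_affine:
  assumes "taylor3 M g g1 g2" "s > 0"
  shows "taylor3 (M / s ^ 3) (\<lambda>x. g ((x - a) / s)) (\<lambda>x. g1 ((x - a) / s) / s) (\<lambda>x. g2 ((x - a) / s) / s\<^sup>2)"
  unfolding taylor3_def
proof (intro conjI allI)
  have [measurable]: "g1 \<in> borel_measurable borel" using assms unfolding taylor3_def by auto
  show "(\<lambda>x. g1 ((x - a) / s) / s) \<in> borel_measurable borel" by measurable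
  fix x t
  have "\<bar>g ((x - a) / s + t / s) - g ((x - a) / s) - g1 ((x - a) / s) * (t / s) - g2 ((x - a) / s) * (t / s)\<^sup>2 / 2\<bar>
      \<le> M * \<bar>t / s\<bar> ^ 3"
    using assms unfolding taylor3_def by blast
  moreover have "(x - a) / s + t / s = (x + t - a) / s" by (simp add: diff_divide_distrib add_divide_distrib)
  moreover have "\<bar>t / s\<bar> ^ 3 = \<bar>t\<bar> ^ 3 / s ^ 3" using assms(2) by (simp add: power_divide)
  ultimately have "\<bar>g ((x + t - a) / s) - g ((x - a) / s) - g1 ((x - a) / s) * (t / s) - g2 ((x - a) / s) * (t / s)\<^sup>2 / 2\<bar>
      \<le> M * (\<bar>t\<bar> ^ 3 / s ^ 3)" by (simp only:)
  then show "\<bar>g ((x + t - a) / s) - g ((x - a) / s) - g1 ((x - a) / s) / s * t - g2 ((x - a) / s) / s\<^sup>2 * t\<^sup>2 / 2\<bar>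
      \<le> M / s ^ 3 * \<bar>t\<bar> ^ 3"
    by (simp add: power_divide)
next
  fix x y
  have "\<bar>g2 ((x - a) / s) - g2 ((y - a) / s)\<bar> \<le> 6 * M * \<bar>(x - a) / s - (y - a) / s\<bar>"
    using assms unfolding taylor3_def by blast
  also have "(x - a) / s - (y - a) / s = (x - y) / s" by (simp add: diff_divide_distrib)
  finally have "\<bar>g2 ((x - a) / s) - g2 ((y - a) / s)\<bar> / s\<^sup>2 \<le> 6 * M * \<bar>(x - y) / s\<bar> / s\<^sup>2"
    by (rule divide_right_mono) simp
  also have "\<bar>g2 ((x - a) / s) - g2 ((y - a) / s)\<bar> / s\<^sup>2 = \<bar>g2 ((x - a) / s) / s\<^sup>2 - g2 ((y - a) / s) / s\<^sup>2\<bar>"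
    by (simp flip: diff_divide_distrib)
  also have "6 * M * \<bar>(x - y) / s\<bar> / s\<^sup>2 = 6 * (M / s ^ 3) * \<bar>x - y\<bar>"
    using assms(2) by (simp add: power2_eq_square power3_eq_cube)
  finally show "\<bar>g2 ((x - a) / s) / s\<^sup>2 - g2 ((y - a) / s) / s\<^sup>2\<bar> \<le> 6 * (M / s ^ 3) * \<bar>x - y\<bar>" .
qed

section \<open>A spline as smooth step\<close>

text \<open>The third derivative jumps at 0, yet the second one is Lipschitz, which is all that the
  remainder form asks for. When \<open>x\<close> and \<open>y\<close> lie on the same nonnegative
  side the remainder is exactly \<open>t ^ 3\<close>.\<close>

lemma taylor3_cube_plus:
  "taylor3 1 (\<lambda>x. max 0 x ^ 3) (\<lambda>x. 3 * (max 0 x)\<^sup>2) (\<lambda>x. 6 * max 0 x)"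
  unfolding taylor3_def
proof (intro conjI allI)
  fix x t :: real
  define y where "y = x + t"
  have t: "t = y - x" by (simp add: y_def)
  have cube: "y ^ 3 - x ^ 3 - 3 * x\<^sup>2 * t - 6 * x * t\<^sup>2 / 2 = t ^ 3"
    unfolding t by (simp add: power2_eq_square power3_eq_cube field_simps)
  have "\<bar>max 0 y ^ 3 - max 0 x ^ 3 - 3 * (max 0 x)\<^sup>2 * t - 6 * max 0 x * t\<^sup>2 / 2\<bar> \<le> \<bar>t\<bar> ^ 3"
  proof (cases "x \<ge> 0"; cases "y \<ge> 0")
    assume "x \<ge> 0" "y \<ge> 0"
    then have m: "max 0 x = x" "max 0 y = y" by auto
    show ?thesis unfolding m cube by (simp add: power_abs)
  next
    \<comment> \<open>The remainder is \<open>t ^ 3 - y ^ 3\<close>, the difference of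
      \<open>(- y) ^ 3\<close> and \<open>\<bar>t\<bar> ^ 3\<close>, where the former lies between 0
      and the latter.\<close>
    assume xy: "x \<ge> 0" "\<not> y \<ge> 0"
    then have m: "max 0 x = x" "max 0 y = 0" by auto
    have "(- y) ^ 3 \<le> \<bar>t\<bar> ^ 3" using xy by (intro power_mono) (auto simp: t)
    moreover have "(- y) ^ 3 \<ge> 0" using xy by (intro zero_le_power) simp
    moreover have "(- y) ^ 3 = - (y ^ 3)" by (rule power_minus_odd) simp
    moreover have "\<bar>t\<bar> ^ 3 = - (t ^ 3)"
    proof -
      have "\<bar>t\<bar> = - t" using xy by (simp add: t)
      then show ?thesis by (simp add: power_minus_odd)
    qed
    moreover have "0 ^ 3 - x ^ 3 - 3 * x\<^sup>2 * t - 6 * x * t\<^sup>2 / 2 = t ^ 3 - y ^ 3"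
      using cube by simp
    ultimately show ?thesis unfolding m by simp
  next
    assume xy: "\<not> x \<ge> 0" "y \<ge> 0"
    then have m: "max 0 x = 0" "max 0 y = y" by auto
    have "y ^ 3 \<le> \<bar>t\<bar> ^ 3" using xy by (intro power_mono) (auto simp: t)
    then show ?thesis unfolding m using xy by simp
  next
    assume xy: "\<not> x \<ge> 0" "\<not> y \<ge> 0"
    then have m: "max 0 x = 0" "max 0 y = 0" by auto
    show ?thesis unfolding m by simp
  qed
  then show "\<bar>max 0 (x + t) ^ 3 - max 0 x ^ 3 - 3 * (max 0 x)\<^sup>2 * t - 6 * max 0 x * t\<^sup>2 / 2\<bar> \<le> 1 * \<bar>t\<bar> ^ 3"
    by (simp add: y_def)
next
  fix x y :: real
  show "\<bar>6 * max 0 x - 6 * max 0 y\<bar> \<le> 6 * 1 * \<bar>x - y\<bar>"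
  proof -
    have "\<bar>max 0 x - max 0 y\<bar> \<le> \<bar>x - y\<bar>" by (auto simp: max_def)
    then have "6 * \<bar>max 0 x - max 0 y\<bar> \<le> 6 * \<bar>x - y\<bar>" by simp
    moreover have "\<bar>6 * max 0 x - 6 * max 0 y\<bar> = 6 * \<bar>max 0 x - max 0 y\<bar>"
      unfolding right_diff_distrib[symmetric] abs_mult by simp
    ultimately show ?thesis by simp
  qed
qed auto

text \<open>One minus the third finite difference of \<open>x \<mapsto> (max 0 x)\<^sup>3 / 6\<close>.\<close>

definition smooth_step :: "real \<Rightarrow> real" where
  "smooth_step x = 1 + (- 1 / 6) * max 0 x ^ 3 + (1 / 2) * max 0 ((x - 1) / 1) ^ 3
     + (- 1 / 2) * max 0 ((x - 2) / 1) ^ 3 + (1 / 6) * max 0 ((x - 3) / 1) ^ 3"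

text \<open>The constants add up to \<open>1/6 + 1/2 + 1/2 + 1/6 = 4/3\<close>, rounded up to 2. The
  divisions by 1 in \<open>smooth_step\<close> match the form of \<open>taylor3_affine\<close> with
  unit scale.\<close>

lemma smooth_step_taylor3: "\<exists>g1 g2. taylor3 2 smooth_step g1 g2"
proof -
  note a = taylor3_affine[OF taylor3_cube_plus, of 1]
  note s = taylor3_add[OF taylor3_add[OF taylor3_add[OF taylor3_add[OF taylor3_const[of 1]
      taylor3_cmult[OF taylor3_cube_plus, of "- 1 / 6"]]
      taylor3_cmult[OF a[of 1], of "1 / 2"]] taylor3_cmult[OF a[of 2], of "- 1 / 2"]]
      taylor3_cmult[OF a[of 3], of "1 / 6"]]
  have mono: "taylor3 M g g1 g2 \<Longrightarrow> M \<le> N \<Longrightarrow> taylor3 N g g1 g2" for M N g g1 g2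
    unfolding taylor3_def by (meson abs_ge_zero mult_left_mono mult_right_mono order_trans zero_le_numeral zero_le_power)
  show ?thesis unfolding smooth_step_def[abs_def]
    by (intro exI, rule mono, rule s) simp_all
qed

lemma smooth_step_left: "x \<le> 0 \<Longrightarrow> smooth_step x = 1"
  by (simp add: smooth_step_def)

text \<open>To the right of 3 no truncation is active, and the third finite difference of
  \<open>x ^ 3 / 6\<close> is the constant 1.\<close>

lemma smooth_step_right: "x \<ge> 3 \<Longrightarrow> smooth_step x = 0"
  by (simp add: smooth_step_def power3_eq_cube algebra_simps)

text \<open>Up to sign the derivative is the quadratic B-spline, a probability density on the
  interval from 0 to 3. The bounds are verified piece by piece.\<close>

lemma smooth_step_bounds: "0 \<le> smooth_step x" "smooth_step x \<le> 1"
proof -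
  consider "x \<le> 0" | "0 \<le> x" "x \<le> 1" | "1 \<le> x" "x \<le> 2" | "2 \<le> x" "x \<le> 3" | "3 \<le> x" by linarith
  then have "0 \<le> smooth_step x \<and> smooth_step x \<le> 1"
  proof cases
    case 2
    then have "smooth_step x = 1 - x ^ 3 / 6" by (simp add: smooth_step_def)
    moreover have "x ^ 3 \<ge> 0" "x ^ 3 \<le> 1" using 2 by (auto simp: power_le_one)
    ultimately show ?thesis by simp
  next
    case 3
    define s where "s = x - 1"
    have s: "0 \<le> s" "s \<le> 1" using 3 by (auto simp: s_def)
    have eq: "smooth_step x = 1 - (1 + 3 * s + 3 * s\<^sup>2 - 2 * s ^ 3) / 6"
      using 3 by (simp add: smooth_step_def s_def power3_eq_cube power2_eq_square field_simps)
    have A: "0 \<le> s\<^sup>2" "s ^ 3 \<le> s\<^sup>2" using s by (auto simp: power_decreasing)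
    have B: "3 * s\<^sup>2 - 2 * s ^ 3 \<le> 1"
    proof -
      have "0 \<le> (1 - s)\<^sup>2 * (1 + 2 * s)" using s by simp
      also have "\<dots> = 1 - 3 * s\<^sup>2 + 2 * s ^ 3" by (simp add: power2_eq_square power3_eq_cube algebra_simps)
      finally show ?thesis by simp
    qed
    \<comment> \<open>With \<open>u\<close> and \<open>v\<close> for the square and the cube of
      \<open>s\<close>, the claim becomes linear.\<close>
    have "0 \<le> 1 - (1 + 3 * s + 3 * u - 2 * v) / 6 \<and> 1 - (1 + 3 * s + 3 * u - 2 * v) / 6 \<le> 1"
      if "0 \<le> u" "v \<le> u" "3 * u - 2 * v \<le> 1" for u v :: real
      using that s by auto
    from this[OF A B] show ?thesis unfolding eq .
  next
    case 4
    then have eq: "smooth_step x = (3 - x) ^ 3 / 6"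
      by (simp add: smooth_step_def power3_eq_cube field_simps)
    have "(3 - x) ^ 3 \<le> 1" using 4 by (intro power_le_one) auto
    then show ?thesis using 4 unfolding eq by simp
  qed (simp_all add: smooth_step_left smooth_step_right)
  then show "0 \<le> smooth_step x" "smooth_step x \<le> 1" by auto
qed

section \<open>The normal distribution function and its smoothing\<close>

text \<open>The standard normal density is at most 1.\<close>

lemma std_normal_interval_le:
  assumes "\<delta> \<ge> 0"
  shows "measure std_normal_distribution {..t + \<delta>} \<le> measure std_normal_distribution {..t} + \<delta>"
proof -
  interpret prob_space std_normal_distribution by (rule prob_space_std_normal)
  have "{..t + \<delta>} = {..t} \<union> {t<..t + \<delta>}" using assms by auto
  then have "measure std_normal_distribution {..t + \<delta>}
      \<le> measure std_normal_distribution {..t} + measure std_normal_distribution {t<..t + \<delta>}"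
    using measure_Un_le[of "{..t}" std_normal_distribution "{t<..t + \<delta>}"] by simp
  also have "measure std_normal_distribution {t<..t + \<delta>} \<le> \<delta>"
  proof -
    have "emeasure std_normal_distribution {t<..t + \<delta>}
        = (\<integral>\<^sup>+x. ennreal (std_normal_density x) * indicator {t<..t + \<delta>} x \<partial>lborel)"
      by (subst emeasure_density) auto
    also have "\<dots> \<le> (\<integral>\<^sup>+x. indicator {t<..t + \<delta>} x \<partial>lborel)"
    proof (rule nn_integral_mono)
      fix x
      have "std_normal_density x \<le> 1"
      proof -
        have "1 \<le> sqrt (2 * pi)" using pi_gt3 by simp
        then have "1 / sqrt (2 * pi) \<le> 1" by simp
        moreover have "exp (- x\<^sup>2 / 2) \<le> 1" by simp
        ultimately show ?thesis unfolding std_normal_density_def by (intro mult_le_one) auto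
      qed
      then show "ennreal (std_normal_density x) * indicator {t<..t + \<delta>} x \<le> indicator {t<..t + \<delta>} x"
        by (auto split: split_indicator)
    qed
    also have "\<dots> = ennreal \<delta>" using assms by simp
    finally show ?thesis using assms by (simp add: emeasure_eq_measure)
  qed
  finally show ?thesis by simp
qed

text \<open>The smoothed step lies between the indicators of the half-lines ending at
  \<open>t\<close> and at \<open>t + 3 * \<delta>\<close>.\<close>

lemma smooth_step_gauss:
  assumes "\<delta> > 0"
  shows "measure std_normal_distribution {..t} \<le> gauss 1 (\<lambda>x. smooth_step ((x - t) / \<delta>)) 0"
    and "gauss 1 (\<lambda>x. smooth_step ((x - t) / \<delta>)) 0 \<le> measure std_normal_distribution {..t + 3 * \<delta>}"
proof -
  interpret prob_space std_normal_distribution by (rule prob_space_std_normal)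
  have [measurable]: "smooth_step \<in> borel_measurable borel"
    using smooth_step_taylor3 taylor3_measurable(1) by blast
  have i: "integrable std_normal_distribution (\<lambda>x. smooth_step ((x - t) / \<delta>))"
    using smooth_step_bounds by (intro integrable_const_bound[where B = 1]) (auto simp: abs_le_iff intro: order_trans[of _ 0])
  have g: "gauss 1 (\<lambda>x. smooth_step ((x - t) / \<delta>)) 0 = (LINT x|std_normal_distribution. smooth_step ((x - t) / \<delta>))"
    by (simp add: gauss_def)
  have m: "measure std_normal_distribution {..u} = (LINT x|std_normal_distribution. indicator {..u} x)" for u
    by simp
  show "measure std_normal_distribution {..t} \<le> gauss 1 (\<lambda>x. smooth_step ((x - t) / \<delta>)) 0"
    unfolding g m
  proof (rule integral_mono[OF _ i])
    show "integrable std_normal_distribution (indicator {..t} :: real \<Rightarrow> real)"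
      by (simp add: integrable_indicator_iff flip: less_top)
    show "indicator {..t} x \<le> smooth_step ((x - t) / \<delta>)" for x
      using assms smooth_step_bounds(1)[of "(x - t) / \<delta>"]
      by (auto simp: smooth_step_left divide_nonpos_pos split: split_indicator)
  qed
  show "gauss 1 (\<lambda>x. smooth_step ((x - t) / \<delta>)) 0 \<le> measure std_normal_distribution {..t + 3 * \<delta>}"
    unfolding g m
  proof (rule integral_mono[OF i])
    show "integrable std_normal_distribution (indicator {..t + 3 * \<delta>} :: real \<Rightarrow> real)"
      by (simp add: integrable_indicator_iff flip: less_top)
    show "smooth_step ((x - t) / \<delta>) \<le> indicator {..t + 3 * \<delta>} x" for x
      using assms smooth_step_bounds(2)[of "(x - t) / \<delta>"]
      by (auto simp: smooth_step_right pos_le_divide_eq split: split_indicator)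
  qed
qed

section \<open>Bounds for the normalised law\<close>

context base_addition
begin

text \<open>Apply \<open>lindeberg\<close> to \<open>h (x / s)\<close> with \<open>s\<close> the
  standard deviation: the Taylor constant scales by \<open>s ^ 3\<close> and the variance is
  \<open>s\<close> squared, leaving an error of order \<open>1 / s\<close>.\<close>

lemma normalized_bound:
  assumes h: "taylor3 M h h1 h2" and r: "r \<ge> 1"
  shows "((\<lambda>d. mu b r d * h (real_of_int d / sigma b r)) has_sum expect_tilde b r h) UNIV"
    and "\<bar>expect_tilde b r h - gauss 1 h 0\<bar> \<le> 18 * real b * M / sqrt (real (rho b r))"
proof -
  define s where "s = sqrt total_var"
  have rho: "rho b r \<ge> 1" "real (rho b r) / 2 \<le> total_var" using rho_le_total_var[OF r] by auto
  then have total_var: "total_var > 0" by linarith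
  then have s: "s > 0" by (simp add: s_def)
  note M = taylor3_nonneg[OF h]
  have sig: "sigma b r = s" by (simp add: sigma_eq s_def)
  obtain S where S: "((\<lambda>d. mu b r d * h (real_of_int d / s)) has_sum S) UNIV"
    "\<bar>S - gauss total_var (\<lambda>x. h (x / s)) 0\<bar> \<le> 9 * (M / s ^ 3) * real b * total_var"
    using lindeberg[OF taylor3_affine[OF h s, of 0]] by auto
  have E: "expect_tilde b r h = S"
    unfolding expect_tilde_def sig using S(1) by (rule infsumI)
  show "((\<lambda>d. mu b r d * h (real_of_int d / sigma b r)) has_sum expect_tilde b r h) UNIV"
    unfolding E sig by (rule S)
  have G: "gauss total_var (\<lambda>x. h (x / s)) 0 = gauss 1 h 0"
    using s by (simp add: gauss_def s_def)
  have "9 * (M / s ^ 3) * real b * total_var = 9 * real b * M / s"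
    using s total_var by (simp add: s_def power3_eq_cube field_simps)
  also have "\<dots> \<le> 9 * real b * M / (sqrt (real (rho b r)) / 2)"
  proof (rule divide_left_mono)
    \<comment> \<open>The variance is at least half the number of blocks; weakening this to a
      quarter gives a rational constant.\<close>
    have "sqrt (real (rho b r)) / 2 = sqrt (real (rho b r) / 4)" by (simp add: real_sqrt_divide)
    also have "\<dots> \<le> s" unfolding s_def using rho by (intro real_sqrt_le_mono) linarith
    finally show "sqrt (real (rho b r)) / 2 \<le> s" .
  qed (use rho s M in auto)
  finally show "\<bar>expect_tilde b r h - gauss 1 h 0\<bar> \<le> 18 * real b * M / sqrt (real (rho b r))"
    using S(2) unfolding E G by simp
qed

lemma cdf_tilde_smooth:
  assumes r: "r \<ge> 1" and \<delta>: "\<delta> > 0"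
  shows "cdf_tilde b r t \<le> expect_tilde b r (\<lambda>x. smooth_step ((x - t) / \<delta>))"
    and "expect_tilde b r (\<lambda>x. smooth_step ((x - t) / \<delta>)) \<le> cdf_tilde b r (t + 3 * \<delta>)"
proof -
  obtain h1 h2 where h: "taylor3 2 smooth_step h1 h2" using smooth_step_taylor3 by blast
  have hs: "((\<lambda>d. mu b r d * smooth_step ((real_of_int d / sigma b r - t) / \<delta>)) has_sum
      expect_tilde b r (\<lambda>x. smooth_step ((x - t) / \<delta>))) UNIV"
    using normalized_bound(1)[OF taylor3_affine[OF h \<delta>] r] .
  have sm: "mu b r summable_on A" for A
    using has_sum_mu_one summable_on_subset_banach[of "mu b r" UNIV A] by (auto dest: has_sum_imp_summable)
  \<comment> \<open>Written as a sum over all integers, the distribution function can be compared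
    termwise with the smoothed expectation.\<close>
  have cdf: "((\<lambda>d. mu b r d * of_bool (real_of_int d / sigma b r \<le> u)) has_sum cdf_tilde b r u) UNIV" for u
  proof -
    have "(mu b r has_sum cdf_tilde b r u) {d. real_of_int d / sigma b r \<le> u}"
      unfolding cdf_tilde_def using sm by (rule has_sum_infsum)
    also have "?this \<longleftrightarrow> ?thesis"
      by (rule has_sum_cong_neutral) auto
    finally show ?thesis .
  qed
  show "cdf_tilde b r t \<le> expect_tilde b r (\<lambda>x. smooth_step ((x - t) / \<delta>))"
  proof (rule has_sum_mono[OF cdf hs])
    fix d
    show "mu b r d * of_bool (real_of_int d / sigma b r \<le> t)
        \<le> mu b r d * smooth_step ((real_of_int d / sigma b r - t) / \<delta>)"
      using \<delta> by (intro mult_left_mono mu_nonneg)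
        (auto simp: smooth_step_left smooth_step_bounds divide_nonpos_pos)
  qed
  show "expect_tilde b r (\<lambda>x. smooth_step ((x - t) / \<delta>)) \<le> cdf_tilde b r (t + 3 * \<delta>)"
  proof (rule has_sum_mono[OF hs cdf])
    fix d
    show "mu b r d * smooth_step ((real_of_int d / sigma b r - t) / \<delta>)
        \<le> mu b r d * of_bool (real_of_int d / sigma b r \<le> t + 3 * \<delta>)"
      using \<delta> by (intro mult_left_mono mu_nonneg)
        (auto simp: smooth_step_right smooth_step_bounds pos_le_divide_eq)
  qed
qed

lemma cdf_tilde_bound:
  assumes r: "r \<ge> 1"
  shows "\<bar>cdf_tilde b r t - measure std_normal_distribution {..t}\<bar>
     \<le> (3 + 36 * real b) / real (rho b r) powr (1 / 8)"
proof -
  define \<rho> where "\<rho> = real (rho b r)"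
  have \<rho>: "\<rho> \<ge> 1" using rho_le_total_var(2)[OF r] by (simp add: \<rho>_def)
  \<comment> \<open>This width makes the smoothing error \<open>\<delta>\<close> and the
    approximation error of order \<open>1 / (\<delta> ^ 3 * sqrt \<rho>)\<close> equal in
    order.\<close>
  define \<delta> where "\<delta> = \<rho> powr (- (1 / 8))"
  have \<delta>: "\<delta> > 0" using \<rho> by (simp add: \<delta>_def)
  obtain h1 h2 where h: "taylor3 2 smooth_step h1 h2" using smooth_step_taylor3 by blast
  define e where "e = 18 * real b * (2 / \<delta> ^ 3) / sqrt \<rho>"
  have e: "e = 36 * real b * \<delta>"
  proof -
    have "\<delta> ^ 3 = \<delta> powr real 3" by (rule powr_realpow[symmetric, OF \<delta>])
    also have "\<dots> = \<rho> powr (- (3 / 8))" by (simp add: \<delta>_def powr_powr)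
    finally have 1: "\<delta> ^ 3 = \<rho> powr (- (3 / 8))" .
    have 2: "sqrt \<rho> = \<rho> powr (1 / 2)" using \<rho> by (simp add: powr_half_sqrt)
    have "\<delta> ^ 3 * sqrt \<rho> * \<delta> = \<rho> powr (- (3 / 8) + 1 / 2 + - (1 / 8))"
      unfolding 1 2 by (simp only: \<delta>_def powr_add)
    then have "\<delta> ^ 3 * sqrt \<rho> * \<delta> = 1" using \<rho> by simp
    then have "1 / (\<delta> ^ 3 * sqrt \<rho>) = \<delta>" using \<rho> \<delta> by (simp add: divide_eq_eq ac_simps)
    moreover have "e = 36 * real b * (1 / (\<delta> ^ 3 * sqrt \<rho>))" by (simp add: e_def)
    ultimately show ?thesis by simp
  qed
  have N: "\<bar>expect_tilde b r (\<lambda>x. smooth_step ((x - u) / \<delta>)) - gauss 1 (\<lambda>x. smooth_step ((x - u) / \<delta>)) 0\<bar> \<le> e" for u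
    using normalized_bound(2)[OF taylor3_affine[OF h \<delta>] r] unfolding e_def \<rho>_def .
  let ?\<Phi> = "\<lambda>u. measure std_normal_distribution {..u}"
  have "cdf_tilde b r t \<le> ?\<Phi> t + 3 * \<delta> + e"
    using cdf_tilde_smooth(1)[OF r \<delta>, of t] N[of t] smooth_step_gauss(2)[OF \<delta>, of t]
      std_normal_interval_le[of "3 * \<delta>" t] \<delta> by simp
  \<comment> \<open>For the lower bound the smoothed step starts at \<open>t - 3 * \<delta>\<close>,
    so that it has reached 0 at \<open>t\<close>.\<close>
  moreover have "?\<Phi> t - 3 * \<delta> - e \<le> cdf_tilde b r t"
    using cdf_tilde_smooth(2)[OF r \<delta>, of "t - 3 * \<delta>"] N[of "t - 3 * \<delta>"]
      smooth_step_gauss(1)[OF \<delta>, of "t - 3 * \<delta>"]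
      std_normal_interval_le[of "3 * \<delta>" "t - 3 * \<delta>"] \<delta> by simp
  ultimately have "\<bar>cdf_tilde b r t - ?\<Phi> t\<bar> \<le> 3 * \<delta> + e" by linarith
  also have "3 * \<delta> + e = (3 + 36 * real b) / \<rho> powr (1 / 8)"
  proof -
    have \<delta>': "\<delta> = 1 / \<rho> powr (1 / 8)" unfolding \<delta>_def by (rule powr_minus_divide)
    show ?thesis unfolding e \<delta>' by (simp add: add_divide_distrib)
  qed
  finally show ?thesis by (simp add: \<rho>_def)
qed

end

section \<open>Three times differentiable test functions and conclusion\<close>

text \<open>Lagrange form of the Taylor remainder for the first bound, the mean value inequality for
  the Lipschitz bound.\<close>

lemma taylor3_of_derivatives:
  assumes d1: "\<And>x. (h has_real_derivative h1 x) (at x)"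
    and d2: "\<And>x. (h1 has_real_derivative h2 x) (at x)"
    and d3: "\<And>x. (h2 has_real_derivative h3 x) (at x)"
    and M: "\<And>x. \<bar>h3 x\<bar> \<le> M"
  shows "taylor3 (M / 6) h h1 h2"
  unfolding taylor3_def
proof (intro conjI allI)
  show "h1 \<in> borel_measurable borel"
    using d2 by (intro borel_measurable_continuous_onI continuous_at_imp_continuous_on)
      (blast intro: DERIV_isCont)
  fix x t :: real
  show "\<bar>h (x + t) - h x - h1 x * t - h2 x * t\<^sup>2 / 2\<bar> \<le> M / 6 * \<bar>t\<bar> ^ 3"
  proof (cases "t = 0")
    case False
    define df where "df = (\<lambda>m::nat. if m = 0 then h else if m = 1 then h1 else if m = 2 then h2 else h3)"
    \<comment> \<open>The enclosing interval is taken with \<open>min\<close> and \<open>max\<close>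
      so that increments of either sign are covered.\<close>
    have "\<exists>s. (if x + t < x then x + t < s \<and> s < x else x < s \<and> s < x + t) \<and>
        h (x + t) = (\<Sum>m<3. df m x / fact m * (x + t - x) ^ m) + df 3 s / fact 3 * (x + t - x) ^ 3"
    proof (rule Taylor[where a = "min x (x + t)" and b = "max x (x + t)"])
      show "\<forall>m s. m < 3 \<and> min x (x + t) \<le> s \<and> s \<le> max x (x + t) \<longrightarrow> DERIV (df m) s :> df (Suc m) s"
        using d1 d2 d3 by (auto simp: df_def numeral_3_eq_3 less_Suc_eq)
    qed (use False in \<open>auto simp: df_def\<close>)
    then obtain s where "h (x + t) = (\<Sum>m<3. df m x / fact m * t ^ m) + df 3 s / fact 3 * t ^ 3"
      by auto
    then have "h (x + t) - h x - h1 x * t - h2 x * t\<^sup>2 / 2 = h3 s / 6 * t ^ 3"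
      by (simp add: df_def numeral_3_eq_3 fact_numeral power2_eq_square)
    then have "\<bar>h (x + t) - h x - h1 x * t - h2 x * t\<^sup>2 / 2\<bar> = \<bar>h3 s\<bar> / 6 * \<bar>t\<bar> ^ 3"
      by (simp only: abs_mult abs_divide abs_numeral power_abs)
    also have "\<dots> \<le> M / 6 * \<bar>t\<bar> ^ 3"
      using M[of s] by (intro mult_right_mono divide_right_mono) auto
    finally show ?thesis .
  qed simp
next
  fix x y
  have "\<bar>h2 x - h2 y\<bar> \<le> M * \<bar>x - y\<bar>"
    using field_differentiable_bound[of UNIV h2 h3 M x y] d3 M by (auto intro: has_field_derivative_at_within)
  then show "\<bar>h2 x - h2 y\<bar> \<le> 6 * (M / 6) * \<bar>x - y\<bar>" by simp
qed

theorem theorem3: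
  fixes b :: nat
  assumes b: "b \<ge> 2"
  shows
    "(\<forall>(h::real \<Rightarrow> real) h1 h2 h3.
        (\<forall>x. (h has_real_derivative h1 x) (at x)) \<and>
        (\<forall>x. (h1 has_real_derivative h2 x) (at x)) \<and>
        (\<forall>x. (h2 has_real_derivative h3 x) (at x)) \<and>
        (\<exists>M. \<forall>x. \<bar>h3 x\<bar> \<le> M) \<longrightarrow>
        (\<exists>C R. \<forall>r\<ge>1. real (rho b r) \<ge> R \<longrightarrow>
           \<bar>expect_tilde b r h - (LINT x|lborel. std_normal_density x * h x)\<bar>
             \<le> C / sqrt (real (rho b r))))
     \<and>
     (\<exists>K>0. \<forall>r::nat. r \<ge> 1 \<longrightarrow>
        (\<forall>t::real. \<bar>cdf_tilde b r t - measure std_normal_distribution {..t}\<bar>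
             \<le> K / real (rho b r) powr (1/8)))"
proof (intro conjI allI impI)
  fix h h1 h2 h3 :: "real \<Rightarrow> real"
  assume "(\<forall>x. (h has_real_derivative h1 x) (at x)) \<and> (\<forall>x. (h1 has_real_derivative h2 x) (at x)) \<and>
        (\<forall>x. (h2 has_real_derivative h3 x) (at x)) \<and> (\<exists>M. \<forall>x. \<bar>h3 x\<bar> \<le> M)"
  then obtain M where h: "taylor3 (M / 6) h h1 h2" using taylor3_of_derivatives by metis
  note [measurable] = taylor3_measurable(1)[OF h]
  have G: "gauss 1 h 0 = (LINT x|lborel. std_normal_density x * h x)"
    unfolding gauss_def by (subst integral_density) auto
  have "\<bar>expect_tilde b r h - (LINT x|lborel. std_normal_density x * h x)\<bar>
      \<le> 18 * real b * (M / 6) / sqrt (real (rho b r))" if "r \<ge> 1" for r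
  proof -
    \<comment> \<open>The locale is instantiated separately for each \<open>r\<close>; the constant
      depends only on \<open>b\<close> and \<open>M\<close>, hence is uniform in
      \<open>r\<close>.\<close>
    interpret base_addition b r by unfold_locales (rule b)
    show ?thesis using normalized_bound(2)[OF h that] unfolding G .
  qed
  then show "\<exists>C R. \<forall>r\<ge>1. real (rho b r) \<ge> R \<longrightarrow>
      \<bar>expect_tilde b r h - (LINT x|lborel. std_normal_density x * h x)\<bar> \<le> C / sqrt (real (rho b r))"
    by blast
next
  have "\<bar>cdf_tilde b r t - measure std_normal_distribution {..t}\<bar>
      \<le> (3 + 36 * real b) / real (rho b r) powr (1 / 8)" if "r \<ge> 1" for r t
  proof -
    interpret base_addition b r by unfold_locales (rule b)
    show ?thesis by (rule cdf_tilde_bound[OF that])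
  qed
  then show "\<exists>K>0. \<forall>r::nat. r \<ge> 1 \<longrightarrow>
        (\<forall>t::real. \<bar>cdf_tilde b r t - measure std_normal_distribution {..t}\<bar>
             \<le> K / real (rho b r) powr (1/8))"
    by (intro exI[of _ "3 + 36 * real b"]) auto
qed

end
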